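(* Let $0<T_{\min}<T_{\max}$ and let $A\in\mathbb{R}^{n\times n}$, $B\in\mathbb{R}^{n\times m}$, $C\in\mathbb{R}^{q\times n}$, $A_J\in\mathbb{R}^{n\times n}$, $B_J\in\mathbb{R}^{n\times m_J}$, $C_J\in\mathbb{R}^{q_J\times n}$ be real matrices defining the impulsive open-loop system $$\begin{pmatrix}\dot x(t)\\ y(t)\end{pmatrix}=\begin{pmatrix}A&B\\ C&0\end{pmatrix}\begin{pmatrix}x(t)\\ u(t)\end{pmatrix},\qquad \begin{pmatrix}x(t_k)\\ y_J(k)\end{pmatrix}=\begin{pmatrix}A_J&B_J\\ C_J&0\end{pmatrix}\begin{pmatrix}x(t_k^-)\\ u_J(k)\end{pmatrix},\qquad t\ge 0,\ k\in\mathbb{N}.$$ There exists a clock-dependent dynamic output-feedback controller (as defined in the context) for this system such that the clock-dependent stability LMIs (as defined in the context) are feasible for the corresponding closed-loop system if and only if there exist continuously differentiable maps $X,Y:[0,T_{\max}]\to\mathbb{S}^n$ and continuous matrix-valued maps $K,L,M,N$ on $[0,T_{\max}]$ and $K_J,L_J,M_J,N_J$ on $[T_{\min},T_{\max}]$ (of sizes $n\times n$, $n\times q$, $m\times n$, $m\times q$ and $n\times n$, $n\times q_J$, $m_J\times n$, $m_J\times q_J$, respectively) satisfying $$\mathbf{X}(\tau)\succ 0\quad\text{and}\quad \mathbf{Z}(\tau)+\mathbf{A}(\tau)^T+\mathbf{A}(\tau)\prec 0\qquad\text{for all }\tau\in[0,T_{\max}],$$ as well as $$\begin{pmatrix}\mathbf{X}(\tau)&\mathbf{A}_J(\tau)^T\\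 \mathbf{A}_J(\tau)&\mathbf{X}(0)\end{pmatrix}\succ 0\qquad\text{for all }\tau\in[T_{\min},T_{\max}].$$ Here $$\mathbf{X}:=\begin{pmatrix}Y&I\\ I&X\end{pmatrix},\qquad \mathbf{Z}:=\begin{pmatrix}-\dot Y&0\\ 0&\dot X\end{pmatrix},$$ $$\mathbf{A}:=\begin{pmatrix}AY&A\\ 0&XA\end{pmatrix}+\begin{pmatrix}0&B\\ I&0\end{pmatrix}\begin{pmatrix}K&L\\ M&N\end{pmatrix}\begin{pmatrix}I&0\\ 0&C\end{pmatrix},$$ $$\mathbf{A}_J(\tau):=\begin{pmatrix}A_JY(\tau)&A_J\\ 0&X(0)A_J\end{pmatrix}+\begin{pmatrix}0&B_J\\ I&0\end{pmatrix}\begin{pmatrix}K_J(\tau)&L_J(\tau)\\ M_J(\tau)&N_J(\tau)\end{pmatrix}\begin{pmatrix}I&0\\ 0&C_J\end{pmatrix}.$$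
   Context: $\mathbb{S}^n$ is the set of symmetric real $n\times n$ matrices; $\succ 0$ and $\prec 0$ denote positive and negative definiteness of symmetric matrices; a dot over a matrix-valued map denotes its derivative. $f(t^-)$ denotes the limit from the left. Impulse instants are sequences $0=t_0<t_1<t_2<\dots$ with $t_k-t_{k-1}\in[T_{\min},T_{\max}]$ for all $k\in\mathbb{N}$. The clock is $\theta(t):=t-t_k$ for $t\in[t_k,t_{k+1})$, $k\in\mathbb{N}_0$. Clock-dependent dynamic output-feedback controller: a system with some state dimension $n_c$ of the form $$\begin{pmatrix}\dot x_c(t)\\ u(t)\end{pmatrix}=\begin{pmatrix}A^c(\theta(t))&B^c(\theta(t))\\ C^c(\theta(t))&D^c(\theta(t))\end{pmatrix}\begin{pmatrix}x_c(t)\\ y(t)\end{pmatrix},\qquad \begin{pmatrix}x_c(t_k)\\ u_J(k)\end{pmatrix}=\begin{pmatrix}A_J^c(\theta(t_k^-))&B_J^c(\theta(t_k^-))\\ C_J^c(\theta(t_k^-))&D_J^c(\theta(t_k^-))\end{pmatrix}\begin{pmatrix}x_c(t_k^-)\\ y_J(k)\end{pmatrix}$$ for $t\ge 0$, $k\in\mathbb{N}$, with continuous matrix-valued maps $A^c,B^c,C^c,D^c$ on $[0,T_{\max}]$ and $A^c_J,B^c_J,C^c_J,D^c_J$ on $[T_{\min},T_{\max}]$. Closed-loop system: with $x_{cl}=\begin{pmatrix}x\\ x_c\end{pmatrix}$ it is $\dot x_{cl}(t)=\mathcal{A}(\theta(t))x_{cl}(t)$, $x_{cl}(t_k)=\mathcal{A}_J(\theta(t_k^-))x_{cl}(t_k^-)$,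 where $$\mathcal{A}=\begin{pmatrix}A+BD^cC&BC^c\\ B^cC&A^c\end{pmatrix},\qquad \mathcal{A}_J=\begin{pmatrix}A_J+B_JD_J^cC_J&B_JC_J^c\\ B_J^cC_J&A_J^c\end{pmatrix}.$$ Clock-dependent stability LMIs: they are feasible for the closed-loop system if there exists a continuously differentiable map $\mathcal{X}:[0,T_{\max}]\to\mathbb{S}^{n+n_c}$ with $\mathcal{X}(\tau)\succ 0$ and $\dot{\mathcal{X}}(\tau)+\mathcal{A}(\tau)^T\mathcal{X}(\tau)+\mathcal{X}(\tau)\mathcal{A}(\tau)\prec 0$ for all $\tau\in[0,T_{\max}]$, and $\mathcal{A}_J(\tau)^T\mathcal{X}(0)\mathcal{A}_J(\tau)-\mathcal{X}(\tau)\prec 0$ for all $\tau\in[T_{\min},T_{\max}]$. *)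

theory Defs
  imports Complex_Main "Jordan_Normal_Form.Matrix"
begin

text \<open>Matrices are those with explicit dimensions, since the state dimension of the controller
  is existentially quantified.  That type carries no topology, so continuity and derivatives of
  matrix-valued maps are entrywise.  Matrix-valued maps are total functions on the reals;
  only their values on the interval \<open>S\<close> matter.\<close>

definition continuous_mat_on :: "real set \<Rightarrow> nat \<Rightarrow> nat \<Rightarrow> (real \<Rightarrow> real mat) \<Rightarrow> bool" where
  "continuous_mat_on S nr nc F \<longleftrightarrow>
     (\<forall>t\<in>S. F t \<in> carrier_mat nr nc) \<and>
     (\<forall>i<nr. \<forall>j<nc. continuous_on S (\<lambda>t. F t $$ (i, j)))"

text \<open>The derivative is taken within \<open>S\<close>, hence one-sided at the end points of an interval.\<close>

definition mat_deriv :: "real set \<Rightarrow> (real \<Rightarrow> real mat) \<Rightarrow> real \<Rightarrow> real mat" where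
  "mat_deriv S F t = mat (dim_row (F t)) (dim_col (F t))
     (\<lambda>(i, j). THE d. ((\<lambda>s. F s $$ (i, j)) has_real_derivative d) (at t within S))"

definition C1_mat_on :: "real set \<Rightarrow> nat \<Rightarrow> nat \<Rightarrow> (real \<Rightarrow> real mat) \<Rightarrow> bool" where
  "C1_mat_on S nr nc F \<longleftrightarrow>
     (\<forall>t\<in>S. F t \<in> carrier_mat nr nc) \<and>
     (\<forall>t\<in>S. \<forall>i<nr. \<forall>j<nc. (\<lambda>s. F s $$ (i, j)) differentiable (at t within S)) \<and>
     continuous_mat_on S nr nc (mat_deriv S F)"

definition sym_mats :: "nat \<Rightarrow> real mat set" where
  "sym_mats n = {P \<in> carrier_mat n n. P\<^sup>T = P}"

definition pos_def :: "real mat \<Rightarrow> bool" where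
  "pos_def P \<longleftrightarrow> P \<in> sym_mats (dim_row P) \<and>
     (\<forall>v \<in> carrier_vec (dim_row P). v \<noteq> 0\<^sub>v (dim_row P) \<longrightarrow> v \<bullet> (P *\<^sub>v v) > 0)"

definition neg_def :: "real mat \<Rightarrow> bool" where
  "neg_def P \<longleftrightarrow> P \<in> sym_mats (dim_row P) \<and>
     (\<forall>v \<in> carrier_vec (dim_row P). v \<noteq> 0\<^sub>v (dim_row P) \<longrightarrow> v \<bullet> (P *\<^sub>v v) < 0)"

text \<open>The coefficient maps of a clock-dependent output-feedback controller with \<open>nc\<close> states,
  for a plant with \<open>m\<close> inputs and \<open>q\<close> outputs during flow, and \<open>mJ\<close> inputs and \<open>qJ\<close> outputs
  at the impulses:
  \<open>x\<^sub>c' = Ac x\<^sub>c + Bc y\<close>, \<open>u = Cc x\<^sub>c + Dc y\<close> with the maps evaluated at the clock value, and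
  \<open>x\<^sub>c(t\<^sub>k) = AJc x\<^sub>c(t\<^sub>k-) + BJc y\<^sub>J(k)\<close>, \<open>u\<^sub>J(k) = CJc x\<^sub>c(t\<^sub>k-) + DJc y\<^sub>J(k)\<close>
  with the maps evaluated at the left limit of the clock at \<open>t\<^sub>k\<close>.\<close>

definition clock_controller ::
  "real \<Rightarrow> real \<Rightarrow> nat \<Rightarrow> nat \<Rightarrow> nat \<Rightarrow> nat \<Rightarrow> nat \<Rightarrow>
   (real \<Rightarrow> real mat) \<Rightarrow> (real \<Rightarrow> real mat) \<Rightarrow> (real \<Rightarrow> real mat) \<Rightarrow> (real \<Rightarrow> real mat) \<Rightarrow>
   (real \<Rightarrow> real mat) \<Rightarrow> (real \<Rightarrow> real mat) \<Rightarrow> (real \<Rightarrow> real mat) \<Rightarrow> (real \<Rightarrow> real mat) \<Rightarrow> bool" where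
  "clock_controller Tmin Tmax m q mJ qJ nc Ac Bc Cc Dc AJc BJc CJc DJc \<longleftrightarrow>
     continuous_mat_on {0..Tmax} nc nc Ac \<and>
     continuous_mat_on {0..Tmax} nc q Bc \<and>
     continuous_mat_on {0..Tmax} m nc Cc \<and>
     continuous_mat_on {0..Tmax} m q Dc \<and>
     continuous_mat_on {Tmin..Tmax} nc nc AJc \<and>
     continuous_mat_on {Tmin..Tmax} nc qJ BJc \<and>
     continuous_mat_on {Tmin..Tmax} mJ nc CJc \<and>
     continuous_mat_on {Tmin..Tmax} mJ qJ DJc"

text \<open>The closed-loop matrix with respect to the state \<open>(x, x\<^sub>c)\<close>; flow and jump have the same
  form.\<close>

definition closed_loop ::
  "real mat \<Rightarrow> real mat \<Rightarrow> real mat \<Rightarrow>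
   real mat \<Rightarrow> real mat \<Rightarrow> real mat \<Rightarrow> real mat \<Rightarrow> real mat" where
  "closed_loop A B C Ac Bc Cc Dc =
     four_block_mat (A + B * Dc * C) (B * Cc)
                    (Bc * C)         Ac"

definition clock_LMIs_feasible ::
  "real \<Rightarrow> real \<Rightarrow> nat \<Rightarrow> (real \<Rightarrow> real mat) \<Rightarrow> (real \<Rightarrow> real mat) \<Rightarrow> bool" where
  "clock_LMIs_feasible Tmin Tmax N Acl AJcl \<longleftrightarrow>
     (\<exists>P. C1_mat_on {0..Tmax} N N P \<and>
          (\<forall>\<tau>\<in>{0..Tmax}. P \<tau> \<in> sym_mats N) \<and>
          (\<forall>\<tau>\<in>{0..Tmax}. pos_def (P \<tau>) \<and>
             neg_def (mat_deriv {0..Tmax} P \<tau> + (Acl \<tau>)\<^sup>T * P \<tau> + P \<tau> * Acl \<tau>)) \<and>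
          (\<forall>\<tau>\<in>{Tmin..Tmax}. neg_def ((AJcl \<tau>)\<^sup>T * P 0 * AJcl \<tau> - P \<tau>)))"

definition bold_X :: "nat \<Rightarrow> real mat \<Rightarrow> real mat \<Rightarrow> real mat" where
  "bold_X n X Y = four_block_mat Y (1\<^sub>m n) (1\<^sub>m n) X"

text \<open>The arguments of \<open>bold_Z\<close> are the values of the derivatives of \<open>X\<close> and \<open>Y\<close>.\<close>

definition bold_Z :: "nat \<Rightarrow> real mat \<Rightarrow> real mat \<Rightarrow> real mat" where
  "bold_Z n dX dY = four_block_mat (- dY) (0\<^sub>m n n) (0\<^sub>m n n) dX"

text \<open>\<open>bold_A\<close> is used for the flow with \<open>X(\<tau>)\<close> and \<open>Y(\<tau>)\<close>, and for the jump with \<open>X(0)\<close> and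
  \<open>Y(\<tau>)\<close>.\<close>

definition bold_A ::
  "nat \<Rightarrow> nat \<Rightarrow> nat \<Rightarrow> real mat \<Rightarrow> real mat \<Rightarrow> real mat \<Rightarrow> real mat \<Rightarrow> real mat \<Rightarrow>
   real mat \<Rightarrow> real mat \<Rightarrow> real mat \<Rightarrow> real mat \<Rightarrow> real mat" where
  "bold_A n m q A B C X Y K L M N =
     four_block_mat (A * Y) A (0\<^sub>m n n) (X * A) +
     four_block_mat (0\<^sub>m n n) B (1\<^sub>m n) (0\<^sub>m n m) *
     four_block_mat K L M N *
     four_block_mat (1\<^sub>m n) (0\<^sub>m n n) (0\<^sub>m q n) C"

end

theory Submission
  imports Defs "Jordan_Normal_Form.Determinant"
begin

text \<open>All inequalities are compared by explicit congruences, so no perturbation or compactness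
  argument is needed.

  Necessity: let \<open>P\<close> solve the stability LMIs of the closed loop, with leading block \<open>X\<close>, let
  \<open>Y\<close>, \<open>V\<close> be twice the blocks in the first block column of \<open>P\<^sup>-\<^sup>1\<close>, and put
  \<open>T = (Y, I; V, 0)\<close>, \<open>S = (0, I; 0, 0)\<close>. Then \<open>T\<^sup>T M T + S\<^sup>T M S\<close> is definite whenever \<open>M\<close> is, even if
  \<open>V\<close> is not injective (as happens for \<open>n\<^sub>c < n\<close>), and for \<open>M = P\<close> and for the Lyapunov and jump
  matrices it is twice the corresponding synthesis matrix. The blocks \<open>K\<close> and \<open>K\<^sub>J\<close> are free, so
  they absorb all terms that do not come from the plant.

  Sufficiency: with \<open>W = Y\<^sup>-\<^sup>1\<close> take \<open>n\<^sub>c = n\<close>, \<open>P = (X, W - X; W - X, X - W)\<close> and the invertible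
  \<open>T = (Y, I; Y, 0)\<close>, for which \<open>T\<^sup>T P T\<close> is the bold \<open>X\<close>; the controller is obtained by solving
  \<open>T\<^sup>T P \<A> T\<close> = bold \<open>A\<close>, where during flow \<open>K\<close> is first shifted by \<open>W\<close> times the derivative
  of \<open>Y\<close>.\<close>

subsection \<open>Block matrix algebra\<close>

text \<open>The laws of matrix arithmetic are put in a form whose premises only equate dimensions.
  Such premises are closed by rewriting, whereas carrier premises contain dimensions that the
  simplifier would have to guess.\<close>

lemma dim_mult_assoc:
  fixes A :: "'a :: semiring_0 mat"
  assumes "dim_col A = dim_row B" "dim_col B = dim_row C"
  shows "A * B * C = A * (B * C)"
  by (rule assoc_mult_mat[of A "dim_row A" "dim_col A" B "dim_col B" C "dim_col C"])
     (use assms in auto)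

lemma dim_mult_add_distrib:
  fixes A :: "'a :: semiring_0 mat"
  assumes "dim_col A = dim_row B" "dim_row B = dim_row C" "dim_col B = dim_col C"
  shows "A * (B + C) = A * B + A * C"
  by (rule mult_add_distrib_mat[of A "dim_row A" "dim_col A" B "dim_col B" C])
     (use assms in auto)

lemma dim_add_mult_distrib:
  fixes A :: "'a :: semiring_0 mat"
  assumes "dim_row A = dim_row B" "dim_col A = dim_col B" "dim_col A = dim_row C"
  shows "(A + B) * C = A * C + B * C"
  by (rule add_mult_distrib_mat[of A "dim_row A" "dim_col A" B C "dim_col C"])
     (use assms in auto)

lemma dim_mult_minus_distrib:
  fixes A :: "'a :: ring mat"
  assumes "dim_col A = dim_row B" "dim_row B = dim_row C" "dim_col B = dim_col C"
  shows "A * (B - C) = A * B - A * C"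
  by (rule mult_minus_distrib_mat[of A "dim_row A" "dim_col A" B "dim_col B" C])
     (use assms in auto)

lemma dim_minus_mult_distrib:
  fixes A :: "'a :: ring mat"
  assumes "dim_row A = dim_row B" "dim_col A = dim_col B" "dim_col A = dim_row C"
  shows "(A - B) * C = A * C - B * C"
  by (rule minus_mult_distrib_mat[of A "dim_row A" "dim_col A" B C "dim_col C"])
     (use assms in auto)

lemma dim_mult_uminus:
  fixes A :: "'a :: ring mat"
  assumes "dim_col A = dim_row B"
  shows "A * (- B) = - (A * B)"
  by (rule eq_matI) (use assms in auto)

lemma dim_uminus_mult:
  fixes A :: "'a :: ring mat"
  assumes "dim_col A = dim_row B"
  shows "(- A) * B = - (A * B)"
  by (rule eq_matI) (use assms in auto)

lemma dim_mult_smult: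
  fixes A :: "'a :: comm_semiring_0 mat"
  assumes "dim_col A = dim_row B"
  shows "A * (k \<cdot>\<^sub>m B) = k \<cdot>\<^sub>m (A * B)"
  by (rule eq_matI) (use assms in auto)

lemma dim_smult_mult:
  fixes A :: "'a :: comm_semiring_0 mat"
  assumes "dim_col A = dim_row B"
  shows "(k \<cdot>\<^sub>m A) * B = k \<cdot>\<^sub>m (A * B)"
  by (rule eq_matI) (use assms in auto)

lemma dim_mult_one:
  fixes A :: "'a :: semiring_1 mat"
  shows "dim_col A = n \<Longrightarrow> A * 1\<^sub>m n = A" "dim_row A = n \<Longrightarrow> 1\<^sub>m n * A = A"
  by (auto intro: right_mult_one_mat left_mult_one_mat)

lemma dim_mult_zero:
  fixes A :: "'a :: semiring_0 mat"
  shows "dim_col A = n \<Longrightarrow> A * 0\<^sub>m n k = 0\<^sub>m (dim_row A) k"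
    "dim_row A = n \<Longrightarrow> 0\<^sub>m k n * A = 0\<^sub>m k (dim_col A)"
  by (auto intro: right_mult_zero_mat left_mult_zero_mat)

lemma dim_add_zero:
  fixes A :: "'a :: monoid_add mat"
  shows "dim_row A = n \<Longrightarrow> dim_col A = k \<Longrightarrow> A + 0\<^sub>m n k = A"
    "dim_row A = n \<Longrightarrow> dim_col A = k \<Longrightarrow> 0\<^sub>m n k + A = A"
  by auto

lemma dim_transpose_mult:
  fixes A :: "'a :: comm_semiring_0 mat"
  assumes "dim_col A = dim_row B"
  shows "(A * B)\<^sup>T = B\<^sup>T * A\<^sup>T"
  by (rule transpose_mult[of A "dim_row A" "dim_col A" B "dim_col B"]) (use assms in auto)

lemma dim_transpose_add:
  assumes "dim_row A = dim_row B" "dim_col A = dim_col B"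
  shows "(A + B)\<^sup>T = A\<^sup>T + B\<^sup>T"
  by (rule eq_matI) (use assms in auto)

lemma dim_transpose_minus:
  assumes "dim_row A = dim_row B" "dim_col A = dim_col B"
  shows "(A - B)\<^sup>T = A\<^sup>T - B\<^sup>T"
  by (rule eq_matI) (use assms in auto)

lemma dim_transpose_smult: "(k \<cdot>\<^sub>m A)\<^sup>T = k \<cdot>\<^sub>m A\<^sup>T"
  by (rule eq_matI) auto

lemma dim_mult_four_block:
  fixes A1 :: "'a :: semiring_0 mat"
  assumes "dim_row A1 = dim_row B1" "dim_row C1 = dim_row D1"
    "dim_col A1 = dim_col C1" "dim_col B1 = dim_col D1"
    "dim_row A2 = dim_row B2" "dim_row C2 = dim_row D2"
    "dim_col A2 = dim_col C2" "dim_col B2 = dim_col D2"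
    "dim_col A1 = dim_row A2" "dim_col B1 = dim_row C2"
  shows "four_block_mat A1 B1 C1 D1 * four_block_mat A2 B2 C2 D2 =
    four_block_mat (A1 * A2 + B1 * C2) (A1 * B2 + B1 * D2)
                   (C1 * A2 + D1 * C2) (C1 * B2 + D1 * D2)"
  by (rule mult_four_block_mat[of A1 "dim_row A1" "dim_col A1" B1 "dim_col B1" C1 "dim_row C1"
        D1 A2 "dim_col A2" B2 "dim_col B2" C2 D2]) (metis assms carrier_matI)+

lemma dim_add_four_block:
  assumes "dim_row A1 = dim_row A2" "dim_row B1 = dim_row A2" "dim_row B2 = dim_row A2"
    "dim_row C1 = dim_row D2" "dim_row D1 = dim_row D2" "dim_row C2 = dim_row D2"
    "dim_col A1 = dim_col A2" "dim_col C1 = dim_col A2" "dim_col C2 = dim_col A2"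
    "dim_col B1 = dim_col D2" "dim_col D1 = dim_col D2" "dim_col B2 = dim_col D2"
  shows "four_block_mat A1 B1 C1 D1 + four_block_mat A2 B2 C2 D2 =
    four_block_mat (A1 + A2) (B1 + B2) (C1 + C2) (D1 + D2)"
  by (rule eq_matI) (use assms in auto)

lemma dim_smult_four_block:
  assumes "dim_row B = dim_row A" "dim_col C = dim_col A" "dim_row C = dim_row D"
    "dim_col B = dim_col D"
  shows "k \<cdot>\<^sub>m four_block_mat A B C D =
    four_block_mat (k \<cdot>\<^sub>m A) (k \<cdot>\<^sub>m B) (k \<cdot>\<^sub>m C) (k \<cdot>\<^sub>m D)"
  by (rule eq_matI) (use assms in auto)

lemma dim_transpose_four_block:
  assumes "dim_row B = dim_row A" "dim_col C = dim_col A" "dim_row C = dim_row D"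
    "dim_col B = dim_col D"
  shows "(four_block_mat A B C D)\<^sup>T = four_block_mat A\<^sup>T C\<^sup>T B\<^sup>T D\<^sup>T"
  by (rule eq_matI) (use assms in auto)

text \<open>Normal form for block identities: products are expanded and associated to the right,
  signs and scalars are pulled out of products, and transposes are pushed in to the factors. What
  then remains is rearrangement of sums, which can be checked entry by entry.\<close>

lemmas mat_ring_simps = dim_mult_assoc dim_mult_add_distrib dim_add_mult_distrib
  dim_mult_minus_distrib dim_minus_mult_distrib dim_mult_uminus dim_uminus_mult
  dim_mult_smult dim_smult_mult dim_mult_one dim_mult_zero dim_add_zero dim_transpose_mult
  dim_transpose_add dim_transpose_minus dim_transpose_smult
lemmas mat_block_simps = dim_mult_four_block dim_add_four_block dim_smult_four_block
  dim_transpose_four_block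

text \<open>To be used with \<open>simp only\<close>: together with the default simpset, the carrier conditions of the
  library rules make the simplifier diverge.\<close>

lemmas mat_dim_simps = index_mult_mat(2,3) index_add_mat(2,3) index_minus_mat(2,3)
  index_uminus_mat(2,3) index_smult_mat(2,3) index_transpose_mat(2,3) index_one_mat(2,3)
  index_zero_mat(2,3) index_mat_four_block(2,3)

lemmas mat_norm = mat_ring_simps mat_block_simps mat_dim_simps transpose_transpose transpose_one
  zero_transpose_mat

section \<open>Definite matrices and congruence\<close>

lemma pos_defI:
  assumes "P \<in> carrier_mat n n" "P\<^sup>T = P"
    and "\<And>v. v \<in> carrier_vec n \<Longrightarrow> v \<noteq> 0\<^sub>v n \<Longrightarrow> v \<bullet> (P *\<^sub>v v) > 0"
  shows "pos_def P"
  using assms unfolding pos_def_def sym_mats_def by auto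

lemma pos_defD:
  assumes "pos_def P" "P \<in> carrier_mat n n"
  shows "P\<^sup>T = P" "\<And>v. v \<in> carrier_vec n \<Longrightarrow> v \<noteq> 0\<^sub>v n \<Longrightarrow> v \<bullet> (P *\<^sub>v v) > 0"
    "\<And>v. v \<in> carrier_vec n \<Longrightarrow> v \<bullet> (P *\<^sub>v v) \<ge> 0"
proof -
  show "P\<^sup>T = P" and *: "\<And>v. v \<in> carrier_vec n \<Longrightarrow> v \<noteq> 0\<^sub>v n \<Longrightarrow> v \<bullet> (P *\<^sub>v v) > 0"
    using assms unfolding pos_def_def sym_mats_def by auto
  show "v \<bullet> (P *\<^sub>v v) \<ge> 0" if "v \<in> carrier_vec n" for v
    using *[OF that] assms(2) that by (cases "v = 0\<^sub>v n") (auto simp: less_imp_le)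
qed

text \<open>Carries the congruence results, which are about positive definiteness, over to the
  Lyapunov and jump inequalities.\<close>

lemma neg_def_iff_pos_def_uminus:
  "neg_def P \<longleftrightarrow> pos_def (- P)"
proof -
  have sym: "- P \<in> sym_mats (dim_row P) \<longleftrightarrow> P \<in> sym_mats (dim_row P)"
    unfolding sym_mats_def mem_Collect_eq uminus_carrier_iff_mat
    by (metis transpose_uminus uminus_uminus_mat)
  have form: "v \<bullet> (- P *\<^sub>v v) = - (v \<bullet> (P *\<^sub>v v))"
    if "v \<in> carrier_vec (dim_row P)" "P \<in> sym_mats (dim_row P)" for v
  proof -
    have "dim_col P = dim_row P"
      using that(2) by (simp only: sym_mats_def mem_Collect_eq carrier_mat_def)
    with that(1) show ?thesis by simp
  qed
  show ?thesis
    unfolding neg_def_def pos_def_def index_uminus_mat(2) sym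
    using form by (metis neg_less_0_iff_less minus_minus)
qed

lemma quadratic_form_congruence:
  fixes P T :: "real mat"
  assumes "P \<in> carrier_mat k k" "T \<in> carrier_mat k n" "v \<in> carrier_vec n"
  shows "v \<bullet> ((T\<^sup>T * P * T) *\<^sub>v v) = (T *\<^sub>v v) \<bullet> (P *\<^sub>v (T *\<^sub>v v))"
proof -
  have "(T\<^sup>T * P * T) *\<^sub>v v = T\<^sup>T *\<^sub>v (P *\<^sub>v (T *\<^sub>v v))"
    using assms by (simp add: assoc_mult_mat_vec[of _ n k _ n] assoc_mult_mat_vec[of _ n k _ k])
  also have "v \<bullet> \<dots> = (T *\<^sub>v v) \<bullet> (P *\<^sub>v (T *\<^sub>v v))"
    using transpose_vec_mult_scalar[of "T\<^sup>T" n k "P *\<^sub>v (T *\<^sub>v v)" v] assms by simp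
  finally show ?thesis .
qed

text \<open>The form of the sum at \<open>v\<close> adds the values of the form of \<open>P\<close>
  at \<open>T v\<close> and \<open>S v\<close>, so it vanishes only if both vectors are zero. The
  factors \<open>L\<close> and \<open>L'\<close> make up a left inverse of \<open>T\<close> stacked
  on \<open>S\<close>, which then forces \<open>v\<close> to be zero. Neither \<open>T\<close> nor
  \<open>S\<close> has to be injective by itself.\<close>

lemma pos_def_congruence_sum:
  assumes P: "pos_def P" "P \<in> carrier_mat k k"
    and T: "T \<in> carrier_mat k n" "S \<in> carrier_mat k n"
    and L: "L \<in> carrier_mat n k" "L' \<in> carrier_mat n k" "L * T + L' * S = 1\<^sub>m n"
  shows "pos_def (T\<^sup>T * P * T + S\<^sup>T * P * S)"
proof (rule pos_defI)
  note d = carrier_matD[OF P(2)] carrier_matD[OF T(1)] carrier_matD[OF T(2)]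
  show "T\<^sup>T * P * T + S\<^sup>T * P * S \<in> carrier_mat n n"
    using d by auto
  show "(T\<^sup>T * P * T + S\<^sup>T * P * S)\<^sup>T = T\<^sup>T * P * T + S\<^sup>T * P * S"
    by (simp add: mat_ring_simps d pos_defD(1)[OF P])
  fix v :: "real vec" assume v: "v \<in> carrier_vec n" "v \<noteq> 0\<^sub>v n"
  have "v = (L * T + L' * S) *\<^sub>v v" using v L by simp
  also have "\<dots> = L *\<^sub>v (T *\<^sub>v v) + L' *\<^sub>v (S *\<^sub>v v)"
    using v L(1,2) T by (simp add: add_mult_distrib_mat_vec[of _ n n]
        assoc_mult_mat_vec[of _ n k _ n])
  finally have "T *\<^sub>v v \<noteq> 0\<^sub>v k \<or> S *\<^sub>v v \<noteq> 0\<^sub>v k"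
    using v L by auto
  then have "(T *\<^sub>v v) \<bullet> (P *\<^sub>v (T *\<^sub>v v)) + (S *\<^sub>v v) \<bullet> (P *\<^sub>v (S *\<^sub>v v)) > 0"
    using pos_defD(2,3)[OF P, of "T *\<^sub>v v"] pos_defD(2,3)[OF P, of "S *\<^sub>v v"] T v
    by (fastforce simp: add_pos_nonneg add_nonneg_pos)
  moreover have "v \<bullet> ((T\<^sup>T * P * T + S\<^sup>T * P * S) *\<^sub>v v) =
      v \<bullet> ((T\<^sup>T * P * T) *\<^sub>v v) + v \<bullet> ((S\<^sup>T * P * S) *\<^sub>v v)"
    using v T P(2)
    by (subst add_mult_distrib_mat_vec[of _ n n])
       (auto intro!: scalar_prod_add_distrib[of _ n] mult_mat_vec_carrier[of _ n n])
  ultimately show "v \<bullet> ((T\<^sup>T * P * T + S\<^sup>T * P * S) *\<^sub>v v) > 0"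
    by (simp only: quadratic_form_congruence[OF P(2) T(1) v(1)]
        quadratic_form_congruence[OF P(2) T(2) v(1)])
qed

text \<open>The case \<open>S = 0\<close>, where \<open>T\<close> itself has a left inverse.\<close>

lemma pos_def_congruence:
  assumes P: "pos_def P" "P \<in> carrier_mat k k" and T: "T \<in> carrier_mat k n"
    and L: "L \<in> carrier_mat n k" "L * T = 1\<^sub>m n"
  shows "pos_def (T\<^sup>T * P * T)"
proof -
  have "pos_def (T\<^sup>T * P * T + (0\<^sub>m k n)\<^sup>T * P * 0\<^sub>m k n)"
    by (rule pos_def_congruence_sum[OF P T _ L(1), of _ "0\<^sub>m n k"]) (use L in auto)
  then show ?thesis using P(2) T by simp
qed

text \<open>For square \<open>T\<close> the one-sided inverse is two-sided, and congruence with
  \<open>L\<close> undoes congruence with \<open>T\<close>.\<close>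

lemma pos_def_congruence_iff:
  assumes P: "P \<in> carrier_mat n n" and T: "T \<in> carrier_mat n n" and L: "L \<in> carrier_mat n n"
    and TL: "T * L = 1\<^sub>m n"
  shows "pos_def (T\<^sup>T * P * T) \<longleftrightarrow> pos_def P"
proof
  note d = carrier_matD[OF P] carrier_matD[OF T] carrier_matD[OF L]
  have LT: "L * T = 1\<^sub>m n" by (rule mat_mult_left_right_inverse[OF T L TL])
  show "pos_def (T\<^sup>T * P * T)" if "pos_def P"
    by (rule pos_def_congruence[OF that P T L LT])
  assume *: "pos_def (T\<^sup>T * P * T)"
  have TL': "L\<^sup>T * T\<^sup>T = 1\<^sub>m n"
    using arg_cong[OF TL, of transpose_mat] by (simp add: mat_ring_simps d)
  have "L\<^sup>T * (T\<^sup>T * P * T) * L = (L\<^sup>T * T\<^sup>T) * P * (T * L)"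
    by (simp add: dim_mult_assoc d)
  then have "L\<^sup>T * (T\<^sup>T * P * T) * L = P"
    by (simp add: TL TL' dim_mult_one d)
  with pos_def_congruence[OF * _ L T TL] show "pos_def P"
    using T P by simp
qed

text \<open>Removes the factor 2 that the two-term congruences of the necessity direction
  produce.\<close>

lemma pos_def_smultD:
  assumes cP: "pos_def (c \<cdot>\<^sub>m P)" and c: "c > 0" and P: "P \<in> carrier_mat n n"
  shows "pos_def P"
proof (rule pos_defI[OF P])
  have cP': "c \<cdot>\<^sub>m P \<in> carrier_mat n n" using P by simp
  show "P\<^sup>T = P"
  proof (rule eq_matI)
    fix i j assume ij: "i < dim_row P" "j < dim_col P"
    have "(c \<cdot>\<^sub>m P)\<^sup>T $$ (i, j) = (c \<cdot>\<^sub>m P) $$ (i, j)"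
      by (simp only: pos_defD(1)[OF cP cP'])
    then show "P\<^sup>T $$ (i, j) = P $$ (i, j)" using ij carrier_matD[OF P] c by simp
  qed (use carrier_matD[OF P] in auto)
  fix v :: "real vec" assume v: "v \<in> carrier_vec n" "v \<noteq> 0\<^sub>v n"
  have "(c \<cdot>\<^sub>m P) *\<^sub>v v = c \<cdot>\<^sub>v (P *\<^sub>v v)"
    by (rule eq_vecI) (use v(1) P in auto)
  then have "v \<bullet> ((c \<cdot>\<^sub>m P) *\<^sub>v v) = c * (v \<bullet> (P *\<^sub>v v))"
    using v(1) P by simp
  then show "v \<bullet> (P *\<^sub>v v) > 0"
    using pos_defD(2)[OF cP cP' v] c by (simp add: zero_less_mult_iff)
qed

text \<open>The quadratic form splits into the forms of the two blocks. One direction tests with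
  vectors supported in a single half, the other uses that a nonzero vector has a nonzero
  half.\<close>

lemma pos_def_block_diag_iff:
  assumes A: "A \<in> carrier_mat n n" and D: "D \<in> carrier_mat k k"
  shows "pos_def (four_block_mat A (0\<^sub>m n k) (0\<^sub>m k n) D) \<longleftrightarrow> pos_def A \<and> pos_def D"
proof -
  let ?P = "four_block_mat A (0\<^sub>m n k) (0\<^sub>m k n) D"
  note d = carrier_matD[OF A] carrier_matD[OF D]
  have P: "?P \<in> carrier_mat (n + k) (n + k)" using A D by simp
  have form: "(a @\<^sub>v b) \<bullet> (?P *\<^sub>v (a @\<^sub>v b)) = a \<bullet> (A *\<^sub>v a) + b \<bullet> (D *\<^sub>v b)"
    if "a \<in> carrier_vec n" "b \<in> carrier_vec k" for a b
    using that A D by (simp add: mult_mat_vec_split scalar_prod_append[of _ n _ k])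
  have zero: "a @\<^sub>v b = 0\<^sub>v (n + k) \<longleftrightarrow> a = 0\<^sub>v n \<and> b = 0\<^sub>v k"
    if "a \<in> carrier_vec n" "b \<in> carrier_vec k" for a b :: "real vec"
  proof -
    have "0\<^sub>v (n + k) = 0\<^sub>v n @\<^sub>v (0\<^sub>v k :: real vec)" by auto
    then show ?thesis using that append_vec_eq[of a n "0\<^sub>v n" b "0\<^sub>v k"] by auto
  qed
  have sym: "?P\<^sup>T = four_block_mat A\<^sup>T (0\<^sub>m n k) (0\<^sub>m k n) D\<^sup>T"
    by (simp add: dim_transpose_four_block d)
  show ?thesis
  proof
    assume L: "pos_def ?P"
    note Ls = pos_defD(1)[OF L P, unfolded sym]
    show "pos_def A \<and> pos_def D"
    proof
      show "pos_def A"
      proof (rule pos_defI[OF A])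
        show "A\<^sup>T = A"
        proof (rule eq_matI)
          fix i j assume "i < dim_row A" "j < dim_col A"
          then show "A\<^sup>T $$ (i, j) = A $$ (i, j)"
            using arg_cong[OF Ls, of "\<lambda>M. M $$ (i, j)"] d by simp
        qed (use d in auto)
        fix v :: "real vec" assume v: "v \<in> carrier_vec n" "v \<noteq> 0\<^sub>v n"
        show "v \<bullet> (A *\<^sub>v v) > 0"
          using pos_defD(2)[OF L P, of "v @\<^sub>v 0\<^sub>v k"] form[of v "0\<^sub>v k"] zero[of v "0\<^sub>v k"] v D
          by (simp add: append_carrier_vec)
      qed
      show "pos_def D"
      proof (rule pos_defI[OF D])
        show "D\<^sup>T = D"
        proof (rule eq_matI)
          fix i j assume "i < dim_row D" "j < dim_col D"
          then show "D\<^sup>T $$ (i, j) = D $$ (i, j)"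
            using arg_cong[OF Ls, of "\<lambda>M. M $$ (n + i, n + j)"] d by simp
        qed (use d in auto)
        fix v :: "real vec" assume v: "v \<in> carrier_vec k" "v \<noteq> 0\<^sub>v k"
        show "v \<bullet> (D *\<^sub>v v) > 0"
          using pos_defD(2)[OF L P, of "0\<^sub>v n @\<^sub>v v"] form[of "0\<^sub>v n" v] zero[of "0\<^sub>v n" v] v A
          by (simp add: append_carrier_vec)
      qed
    qed
  next
    assume R: "pos_def A \<and> pos_def D"
    then have RA: "pos_def A" and RD: "pos_def D" by auto
    show "pos_def ?P"
    proof (rule pos_defI[OF P])
      show "?P\<^sup>T = ?P"
        by (simp add: sym pos_defD(1)[OF RA A] pos_defD(1)[OF RD D])
      fix v :: "real vec" assume v: "v \<in> carrier_vec (n + k)" "v \<noteq> 0\<^sub>v (n + k)"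
      define a b where "a = vec_first v n" and "b = vec_last v k"
      have ab: "a \<in> carrier_vec n" "b \<in> carrier_vec k" "v = a @\<^sub>v b"
        using v by (auto simp: a_def b_def vec_first_last_append)
      have "a \<noteq> 0\<^sub>v n \<or> b \<noteq> 0\<^sub>v k" using v ab zero by blast
      then show "v \<bullet> (?P *\<^sub>v v) > 0"
        unfolding ab(3) form[OF ab(1,2)]
        using pos_defD(2,3)[OF RA A ab(1)] pos_defD(2,3)[OF RD D ab(2)]
        by (auto simp: add_pos_nonneg add_nonneg_pos)
    qed
  qed
qed

text \<open>Completing the square in the jump inequality, without inverting \<open>P\<^sub>0\<close>.\<close>

lemma pos_def_jump_block_iff:
  assumes P: "P \<in> carrier_mat k k" and P0: "P0 \<in> carrier_mat k k"
    and A: "A \<in> carrier_mat k k"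
  shows "pos_def (four_block_mat P (A\<^sup>T * P0) (P0 * A) P0) \<longleftrightarrow>
    pos_def (P - A\<^sup>T * P0 * A) \<and> pos_def P0"
proof -
  note d = carrier_matD[OF P] carrier_matD[OF P0] carrier_matD[OF A]
  \<comment> \<open>\<open>?T\<close> is the shear taking \<open>(a, b)\<close> to
    \<open>(a, A a + b)\<close>, and \<open>?L\<close> is the opposite shear. The form of the jump
    block matrix at \<open>(a, b)\<close> is the form of \<open>?D\<close> at the sheared
    vector.\<close>
  let ?T = "four_block_mat (1\<^sub>m k) (0\<^sub>m k k) A (1\<^sub>m k)"
  let ?L = "four_block_mat (1\<^sub>m k) (0\<^sub>m k k) (- A) (1\<^sub>m k)"
  let ?D = "four_block_mat (P - A\<^sup>T * P0 * A) (0\<^sub>m k k) (0\<^sub>m k k) P0"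
  have TL: "?T * ?L = 1\<^sub>m (k + k)"
    unfolding four_block_one_mat[symmetric]
    by (simp only: mat_norm d, rule cong_four_block_mat) (auto simp: d)
  \<comment> \<open>Without \<open>index_mult_mat(1)\<close> the entries of products stay atomic, so
    the entrywise comparison is linear.\<close>
  have "?T\<^sup>T * ?D * ?T = four_block_mat P (A\<^sup>T * P0) (P0 * A) P0"
    by (simp only: mat_norm d, rule cong_four_block_mat)
      (auto simp: d simp del: index_mult_mat(1) intro!: eq_matI)
  moreover have "pos_def (?T\<^sup>T * ?D * ?T) \<longleftrightarrow> pos_def ?D"
    by (rule pos_def_congruence_iff[OF _ _ _ TL]) (use P P0 A in auto)
  moreover have "pos_def ?D \<longleftrightarrow> pos_def (P - A\<^sup>T * P0 * A) \<and> pos_def P0"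
    by (rule pos_def_block_diag_iff) (use P P0 A in auto)
  ultimately show ?thesis by simp
qed

subsection \<open>Congruences for the closed loop\<close>

text \<open>Symmetry of \<open>P\<close> makes the two Lyapunov products transposes of each other,
  so only \<open>T\<^sup>T * P * A * T\<close> has to be computed later.\<close>

lemma flow_congruence:
  fixes P P' A T :: "real mat"
  assumes "P \<in> carrier_mat k k" "P' \<in> carrier_mat k k" "A \<in> carrier_mat k k"
    "T \<in> carrier_mat k n" and sym: "P\<^sup>T = P"
  shows "T\<^sup>T * (P' + A\<^sup>T * P + P * A) * T =
    T\<^sup>T * P' * T + (T\<^sup>T * P * A * T)\<^sup>T + T\<^sup>T * P * A * T"
proof -
  note d = assms(1-4)[THEN carrier_matD(1)] assms(1-4)[THEN carrier_matD(2)]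
  show ?thesis by (simp only: mat_norm d sym)
qed

text \<open>Two congruence matrices occur because a jump compares \<open>P\<close> at the clock
  value before the impulse with \<open>P\<close> at clock value 0. Each of them is transformed by
  the matrix built from its own blocks.\<close>

lemma jump_congruence:
  fixes P P0 A T :: "real mat"
  assumes "P \<in> carrier_mat k k" "P0 \<in> carrier_mat k k" "A \<in> carrier_mat k k"
    "T \<in> carrier_mat k n" "T0 \<in> carrier_mat k n" and sym: "P0\<^sup>T = P0"
  shows "(four_block_mat T (0\<^sub>m k n) (0\<^sub>m k n) T0)\<^sup>T *
      four_block_mat P (A\<^sup>T * P0) (P0 * A) P0 * four_block_mat T (0\<^sub>m k n) (0\<^sub>m k n) T0 =
    four_block_mat (T\<^sup>T * P * T) ((T0\<^sup>T * P0 * A * T)\<^sup>T) (T0\<^sup>T * P0 * A * T) (T0\<^sup>T * P0 * T0)"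
proof -
  note d = assms(1-5)[THEN carrier_matD(1)] assms(1-5)[THEN carrier_matD(2)]
  show ?thesis by (simp only: mat_norm d sym)
qed

text \<open>The block \<open>2 I\<close> in \<open>T0\<^sup>T * P\<close> doubles the upper block
  row. The lower right block occurs once in each summand, as \<open>S\<close> selects exactly that
  block, and the lower left block occurs only once, which explains the factor 1/2 in the value for
  \<open>K\<close>. Keeping \<open>T0\<close> apart from \<open>T\<close> lets the identity serve
  both the flow (\<open>T0 = T\<close>) and the jump.\<close>

lemma bold_A_of_closed_loop:
  fixes A B C X U Ac Bc Cc Dc Y V P T T0 S :: "real mat"
  assumes car: "A \<in> carrier_mat n n" "B \<in> carrier_mat n m" "C \<in> carrier_mat q n"
    "X \<in> carrier_mat n n" "U \<in> carrier_mat n k"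
    "Y \<in> carrier_mat n n" "V \<in> carrier_mat k n"
    "Ac \<in> carrier_mat k k" "Bc \<in> carrier_mat k q" "Cc \<in> carrier_mat m k" "Dc \<in> carrier_mat m q"
    and T0P: "T0\<^sup>T * P = four_block_mat (2 \<cdot>\<^sub>m 1\<^sub>m n) (0\<^sub>m n k) X U"
    and SP: "S\<^sup>T * P = four_block_mat (0\<^sub>m n n) (0\<^sub>m n k) X U"
    and T: "T = four_block_mat Y (1\<^sub>m n) V (0\<^sub>m k n)"
    and S: "S = four_block_mat (0\<^sub>m n n) (1\<^sub>m n) (0\<^sub>m k n) (0\<^sub>m k n)"
  shows "T0\<^sup>T * P * closed_loop A B C Ac Bc Cc Dc * T + S\<^sup>T * P * closed_loop A B C Ac Bc Cc Dc * S =
    2 \<cdot>\<^sub>m bold_A n m q A B C X Y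
      ((1/2) \<cdot>\<^sub>m ((X * (A + B * Dc * C) + U * (Bc * C)) * Y + (X * (B * Cc) + U * Ac) * V))
      (X * (B * Dc) + U * Bc) (Dc * C * Y + Cc * V) Dc"
proof -
  note d = car[THEN carrier_matD(1)] car[THEN carrier_matD(2)]
  show ?thesis
    unfolding T0P SP
    by (simp only: T S closed_loop_def bold_A_def mat_norm d, rule cong_four_block_mat)
      (auto simp: d distrib_left simp del: index_mult_mat(1) intro!: eq_matI)
qed

text \<open>The equations for the controller are triangular: \<open>N\<close> is the feedthrough,
  then \<open>M\<close> determines the output map through \<open>W\<close>, \<open>L\<close>
  determines the input map through \<open>Ui\<close>, and finally \<open>K\<close> determines the
  state matrix through both inverses.\<close>

lemma bold_A_of_controller:
  fixes A B C X U Ui W Y K L M N P T T0 :: "real mat"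
  assumes car: "A \<in> carrier_mat n n" "B \<in> carrier_mat n m" "C \<in> carrier_mat q n"
    "X \<in> carrier_mat n n" "Y \<in> carrier_mat n n" "U \<in> carrier_mat n n" "Ui \<in> carrier_mat n n"
    "W \<in> carrier_mat n n"
    "K \<in> carrier_mat n n" "L \<in> carrier_mat n q" "M \<in> carrier_mat m n" "N \<in> carrier_mat m q"
    and inv: "W * Y = 1\<^sub>m n" "U * Ui = 1\<^sub>m n"
    and T0P: "T0\<^sup>T * P = four_block_mat (1\<^sub>m n) (0\<^sub>m n n) X U"
    and T: "T = four_block_mat Y (1\<^sub>m n) Y (0\<^sub>m n n)"
  shows "T0\<^sup>T * P * closed_loop A B C
      (Ui * (K - X * A * Y - X * B * M - (L - X * B * N) * C * Y) * W)
      (Ui * (L - X * B * N)) ((M - N * C * Y) * W) N * T =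
    bold_A n m q A B C X Y K L M N"
proof -
  note d = car[THEN carrier_matD(1)] car[THEN carrier_matD(2)]
  \<comment> \<open>In right-associated products \<open>U\<close> and \<open>Ui\<close> meet only in
    front of a further factor, where the plain inverse law does not match.\<close>
  have inv': "U * (Ui * Z) = Z" if "dim_row Z = n" for Z
    using that by (simp add: dim_mult_assoc[symmetric] d inv dim_mult_one)
  show ?thesis
    unfolding T0P
    by (simp only: T closed_loop_def bold_A_def mat_norm d inv inv', rule cong_four_block_mat)
      (auto simp: d distrib_left simp del: index_mult_mat(1) intro!: eq_matI)
qed

text \<open>\<open>K\<close> enters only the lower left block. This is what allows off-diagonal
  derivative terms to be absorbed by changing \<open>K\<close>.\<close>

lemma bold_A_add_K:
  assumes "A \<in> carrier_mat n n" "B \<in> carrier_mat n m" "C \<in> carrier_mat q n"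
    "X \<in> carrier_mat n n" "Y \<in> carrier_mat n n"
    "K \<in> carrier_mat n n" "L \<in> carrier_mat n q" "M \<in> carrier_mat m n" "N \<in> carrier_mat m q"
    "K' \<in> carrier_mat n n"
  shows "bold_A n m q A B C X Y (K + K') L M N =
    bold_A n m q A B C X Y K L M N + four_block_mat (0\<^sub>m n n) (0\<^sub>m n n) K' (0\<^sub>m n n)"
proof -
  note d = assms[THEN carrier_matD(1)] assms[THEN carrier_matD(2)]
  show ?thesis
    by (simp only: bold_A_def mat_norm d)
qed

lemma bold_A_dim:
  assumes "C \<in> carrier_mat q n" "X \<in> carrier_mat n n" "A \<in> carrier_mat n n"
  shows "dim_row (bold_A n m q A B C X Y K L M N) = n + n"
    "dim_col (bold_A n m q A B C X Y K L M N) = n + n"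
  using assms[THEN carrier_matD(1)] assms[THEN carrier_matD(2)]
  by (simp_all only: bold_A_def mat_dim_simps)

section \<open>Blocks of a matrix and of a symmetric inverse\<close>

definition sub_block :: "nat \<Rightarrow> nat \<Rightarrow> nat \<Rightarrow> nat \<Rightarrow> 'a mat \<Rightarrow> 'a mat" where
  "sub_block r c h w M = mat h w (\<lambda>(i, j). M $$ (r + i, c + j))"

lemma sub_block_carrier: "sub_block r c h w M \<in> carrier_mat h w"
  by (simp add: sub_block_def)

lemma four_block_sub_block:
  assumes "M \<in> carrier_mat (n + k) (n + k)"
  shows "four_block_mat (sub_block 0 0 n n M) (sub_block 0 n n k M)
    (sub_block n 0 k n M) (sub_block n n k k M) = M"
  by (rule eq_matI) (use carrier_matD[OF assms] in \<open>auto simp: sub_block_def\<close>)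

lemma sub_block_four_block:
  assumes "dim_row A = n" "dim_col A = n" "dim_row D = k" "dim_col D = k"
  shows "sub_block 0 0 n n (four_block_mat A B C D) = A"
    "dim_row C = k \<Longrightarrow> dim_col C = n \<Longrightarrow> sub_block n 0 k n (four_block_mat A B C D) = C"
  by (rule eq_matI; use assms in \<open>simp add: sub_block_def\<close>)+

lemma sub_block_transpose:
  assumes "M \<in> carrier_mat (n + k) (n + k)" "r + h \<le> n + k" "c + w \<le> n + k"
  shows "(sub_block r c h w M)\<^sup>T = sub_block c r w h M\<^sup>T"
  by (rule eq_matI) (use carrier_matD[OF assms(1)] assms(2,3) in \<open>auto simp: sub_block_def\<close>)

text \<open>The transpose of \<open>R\<close> is again a left inverse of the symmetric
  \<open>P\<close>, and a left inverse agrees with the right inverse \<open>R\<close>.\<close>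

lemma inverse_transpose_sym:
  fixes P :: "real mat"
  assumes P: "P \<in> carrier_mat n n" "P\<^sup>T = P" and R: "R \<in> carrier_mat n n" and PR: "P * R = 1\<^sub>m n"
  shows "R\<^sup>T = R" "R * P = 1\<^sub>m n"
proof -
  note d = carrier_matD[OF P(1)] carrier_matD[OF R]
  show RP: "R * P = 1\<^sub>m n" by (rule mat_mult_left_right_inverse[OF P(1) R PR])
  have "R\<^sup>T * P = 1\<^sub>m n"
    using arg_cong[OF PR, of transpose_mat] by (simp only: mat_norm d P(2))
  then have "R\<^sup>T * (P * R) = R"
    by (simp only: dim_mult_assoc[symmetric] d mat_dim_simps dim_mult_one)
  then show "R\<^sup>T = R" by (simp only: PR d mat_dim_simps dim_mult_one)
qed

section \<open>Necessity: from a closed-loop certificate to the synthesis inequalities\<close>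

text \<open>The congruence with \<open>T\<close> alone yields the synthesis blocks built from the leading block of
  \<open>P\<^sup>-\<^sup>1\<close>, but only semidefinite ones, since \<open>V\<close> need not be injective. Adding the congruence with
  \<open>S\<close>, that is, doubling \<open>Y\<close>, makes them definite.\<close>

lemma necessity_blocks:
  fixes P P' X X' U U' Q Q' Y V T S :: "real mat"
  assumes car: "X \<in> carrier_mat n n" "U \<in> carrier_mat n k" "Q \<in> carrier_mat k k"
    "X' \<in> carrier_mat n n" "U' \<in> carrier_mat n k" "Q' \<in> carrier_mat k k"
    "Y \<in> carrier_mat n n" "V \<in> carrier_mat k n"
    and P: "P = four_block_mat X U U\<^sup>T Q" and P': "P' = four_block_mat X' U' U'\<^sup>T Q'"
    and sym: "X\<^sup>T = X" "Q\<^sup>T = Q" "Y\<^sup>T = Y" "X'\<^sup>T = X'" "Q'\<^sup>T = Q'"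
    and inv: "X * Y + U * V = 2 \<cdot>\<^sub>m 1\<^sub>m n" "U\<^sup>T * Y + Q * V = 0\<^sub>m k n"
    and T: "T = four_block_mat Y (1\<^sub>m n) V (0\<^sub>m k n)"
    and S: "S = four_block_mat (0\<^sub>m n n) (1\<^sub>m n) (0\<^sub>m k n) (0\<^sub>m k n)"
  shows "T\<^sup>T * P = four_block_mat (2 \<cdot>\<^sub>m 1\<^sub>m n) (0\<^sub>m n k) X U"
    and "S\<^sup>T * P = four_block_mat (0\<^sub>m n n) (0\<^sub>m n k) X U"
    and "T\<^sup>T * P * T + S\<^sup>T * P * S = 2 \<cdot>\<^sub>m bold_X n X Y"
    and "T\<^sup>T * P' * T + S\<^sup>T * P' * S = 2 \<cdot>\<^sub>m four_block_mat
      ((1/2) \<cdot>\<^sub>m (Y * (X' * Y + U' * V) + V\<^sup>T * (U'\<^sup>T * Y + Q' * V)))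
      (((1/2) \<cdot>\<^sub>m (X' * Y + U' * V))\<^sup>T) ((1/2) \<cdot>\<^sub>m (X' * Y + U' * V)) X'"
    and "four_block_mat ((1/2) \<cdot>\<^sub>m X) ((1/2) \<cdot>\<^sub>m U) (0\<^sub>m n n) (0\<^sub>m n k) * T +
      four_block_mat (- ((1/2) \<cdot>\<^sub>m X)) (0\<^sub>m n k) (1\<^sub>m n) (0\<^sub>m n k) * S = 1\<^sub>m (n + n)"
proof -
  note d = car[THEN carrier_matD(1)] car[THEN carrier_matD(2)]
  \<comment> \<open>Transposed, the inverse relations say that the block row
    \<open>(Y, V\<^sup>T)\<close> times \<open>P\<close> is \<open>(2 I, 0)\<close>.\<close>
  have inv': "Y * X + V\<^sup>T * U\<^sup>T = 2 \<cdot>\<^sub>m 1\<^sub>m n" "Y * U + V\<^sup>T * Q = 0\<^sub>m n k"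
    using arg_cong[OF inv(1), of transpose_mat] arg_cong[OF inv(2), of transpose_mat]
    by (simp_all only: mat_norm d sym)
  show TP: "T\<^sup>T * P = four_block_mat (2 \<cdot>\<^sub>m 1\<^sub>m n) (0\<^sub>m n k) X U"
    by (simp only: T P mat_norm d sym inv')
  show SP: "S\<^sup>T * P = four_block_mat (0\<^sub>m n n) (0\<^sub>m n k) X U"
    by (simp only: S P mat_norm d)
  show "T\<^sup>T * P * T + S\<^sup>T * P * S = 2 \<cdot>\<^sub>m bold_X n X Y"
    unfolding TP SP
    by (simp only: T S bold_X_def mat_norm d inv, rule cong_four_block_mat)
      (auto simp: d simp del: index_mult_mat(1) intro!: eq_matI)
  show "T\<^sup>T * P' * T + S\<^sup>T * P' * S = 2 \<cdot>\<^sub>m four_block_mat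
      ((1/2) \<cdot>\<^sub>m (Y * (X' * Y + U' * V) + V\<^sup>T * (U'\<^sup>T * Y + Q' * V)))
      (((1/2) \<cdot>\<^sub>m (X' * Y + U' * V))\<^sup>T) ((1/2) \<cdot>\<^sub>m (X' * Y + U' * V)) X'"
    by (simp only: T S P' mat_norm d sym, rule cong_four_block_mat)
      (auto simp: d simp del: index_mult_mat(1) intro!: eq_matI)
  have half: "(1/2) \<cdot>\<^sub>m (X * Y) + (1/2) \<cdot>\<^sub>m (U * V) = 1\<^sub>m n"
  proof -
    have "(1/2) \<cdot>\<^sub>m (X * Y) + (1/2) \<cdot>\<^sub>m (U * V) = (1/2) \<cdot>\<^sub>m (X * Y + U * V)"
      by (rule eq_matI) (auto simp: d distrib_left simp del: index_mult_mat(1))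
    also have "\<dots> = 1\<^sub>m n" unfolding inv by (rule eq_matI) auto
    finally show ?thesis .
  qed
  \<comment> \<open>The first product has upper row \<open>(I, X/2)\<close> and lower row zero. The
    \<open>S\<close> term cancels \<open>X/2\<close> and supplies the lower right identity, so no
    left inverse of \<open>V\<close> is used.\<close>
  show "four_block_mat ((1/2) \<cdot>\<^sub>m X) ((1/2) \<cdot>\<^sub>m U) (0\<^sub>m n n) (0\<^sub>m n k) * T +
      four_block_mat (- ((1/2) \<cdot>\<^sub>m X)) (0\<^sub>m n k) (1\<^sub>m n) (0\<^sub>m n k) * S = 1\<^sub>m (n + n)"
    unfolding four_block_one_mat[symmetric]
    by (simp only: T S mat_norm d half, rule cong_four_block_mat)
      (auto simp: d simp del: index_mult_mat(1) intro!: eq_matI)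
qed

text \<open>Applies the block computation to the blocks of \<open>P\<close> and of its inverse
  \<open>R\<close>. When \<open>P'\<close> is the derivative of \<open>P\<close>, the matrix
  \<open>- (R * P' * R)\<close> is the derivative of \<open>R\<close>, so the upper left block in
  the fourth claim is minus the derivative of \<open>Y\<close>.\<close>

lemma necessity_matrices:
  fixes P P' R :: "real mat"
  assumes car: "P \<in> carrier_mat (n + k) (n + k)" "R \<in> carrier_mat (n + k) (n + k)"
    "P' \<in> carrier_mat (n + k) (n + k)"
    and sym: "P\<^sup>T = P" "P'\<^sup>T = P'" and PR: "P * R = 1\<^sub>m (n + k)"
  defines "X \<equiv> sub_block 0 0 n n P" and "U \<equiv> sub_block 0 n n k P"
    and "Y \<equiv> 2 \<cdot>\<^sub>m sub_block 0 0 n n R" and "V \<equiv> 2 \<cdot>\<^sub>m sub_block n 0 k n R"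
  defines "T \<equiv> four_block_mat Y (1\<^sub>m n) V (0\<^sub>m k n)"
    and "S \<equiv> four_block_mat (0\<^sub>m n n) (1\<^sub>m n) (0\<^sub>m k n) (0\<^sub>m k n)"
  shows "T\<^sup>T * P = four_block_mat (2 \<cdot>\<^sub>m 1\<^sub>m n) (0\<^sub>m n k) X U"
    and "S\<^sup>T * P = four_block_mat (0\<^sub>m n n) (0\<^sub>m n k) X U"
    and "T\<^sup>T * P * T + S\<^sup>T * P * S = 2 \<cdot>\<^sub>m bold_X n X Y"
    and "T\<^sup>T * P' * T + S\<^sup>T * P' * S = 2 \<cdot>\<^sub>m four_block_mat
      (- (2 \<cdot>\<^sub>m sub_block 0 0 n n (- (R * P' * R)))) ((sub_block 0 0 n n (P' * R))\<^sup>T)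
      (sub_block 0 0 n n (P' * R)) (sub_block 0 0 n n P')"
    and "\<exists>L\<in>carrier_mat (n + n) (n + k). \<exists>L'\<in>carrier_mat (n + n) (n + k).
      L * T + L' * S = 1\<^sub>m (n + n)"
proof -
  define Q where "Q = sub_block n n k k P"
  define X' U' Q' where "X' = sub_block 0 0 n n P'" and "U' = sub_block 0 n n k P'"
    and "Q' = sub_block n n k k P'"
  define R1 R2 R3 where "R1 = sub_block 0 0 n n R" and "R2 = sub_block n 0 k n R"
    and "R3 = sub_block n n k k R"
  note bcar = sub_block_carrier
  have cars: "X \<in> carrier_mat n n" "U \<in> carrier_mat n k" "Q \<in> carrier_mat k k"
    "X' \<in> carrier_mat n n" "U' \<in> carrier_mat n k" "Q' \<in> carrier_mat k k"
    "R1 \<in> carrier_mat n n" "R2 \<in> carrier_mat k n" "R3 \<in> carrier_mat k k"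
    unfolding X_def U_def Q_def X'_def U'_def Q'_def R1_def R2_def R3_def by (rule bcar)+
  note d = cars[THEN carrier_matD(1)] cars[THEN carrier_matD(2)]
  have Rsym: "R\<^sup>T = R" by (rule inverse_transpose_sym[OF car(1) sym(1) car(2) PR])
  have syms: "X\<^sup>T = X" "Q\<^sup>T = Q" "X'\<^sup>T = X'" "Q'\<^sup>T = Q'" "R1\<^sup>T = R1"
    "sub_block n 0 k n P = U\<^sup>T" "sub_block n 0 k n P' = U'\<^sup>T" "sub_block 0 n n k R = R2\<^sup>T"
    unfolding X_def U_def Q_def X'_def U'_def Q'_def R1_def R2_def
    using car sym Rsym by (simp_all add: sub_block_transpose[of _ n k])
  have P: "P = four_block_mat X U U\<^sup>T Q"
    using four_block_sub_block[OF car(1)] unfolding X_def U_def Q_def syms(6)[unfolded U_def] by simp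
  have P': "P' = four_block_mat X' U' U'\<^sup>T Q'"
    using four_block_sub_block[OF car(3)] unfolding X'_def U'_def Q'_def syms(7)[unfolded U'_def] by simp
  have R: "R = four_block_mat R1 R2\<^sup>T R2 R3"
    using four_block_sub_block[OF car(2)] unfolding R1_def R2_def R3_def syms(8)[unfolded R2_def] by simp
  have Y: "Y = 2 \<cdot>\<^sub>m R1" and V: "V = 2 \<cdot>\<^sub>m R2"
    by (simp_all only: Y_def V_def R1_def R2_def)
  have YV: "Y \<in> carrier_mat n n" "V \<in> carrier_mat k n" "Y\<^sup>T = Y"
    using cars(7,8) by (simp_all add: Y V dim_transpose_smult syms)
  have PR': "four_block_mat (X * R1 + U * R2) (X * R2\<^sup>T + U * R3) (U\<^sup>T * R1 + Q * R2)
      (U\<^sup>T * R2\<^sup>T + Q * R3) = four_block_mat (1\<^sub>m n) (0\<^sub>m n k) (0\<^sub>m k n) (1\<^sub>m k)"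
    using PR unfolding P R four_block_one_mat[symmetric] by (simp only: mat_norm d)
  \<comment> \<open>Only the first block column of \<open>P * R = I\<close> is needed. Doubling it
    gives the relations for \<open>Y\<close> and \<open>V\<close>.\<close>
  have blocks: "X * R1 + U * R2 = 1\<^sub>m n" "U\<^sup>T * R1 + Q * R2 = 0\<^sub>m k n"
    using arg_cong[OF PR', of "sub_block 0 0 n n"] arg_cong[OF PR', of "sub_block n 0 k n"]
    by (simp_all only: sub_block_four_block mat_dim_simps d)
  have smult_add: "2 \<cdot>\<^sub>m A + 2 \<cdot>\<^sub>m B = 2 \<cdot>\<^sub>m (A + B)"
    if "dim_row A = dim_row B" "dim_col A = dim_col B" for A B :: "real mat"
    by (rule eq_matI) (use that in auto)
  have inv: "X * Y + U * V = 2 \<cdot>\<^sub>m 1\<^sub>m n" "U\<^sup>T * Y + Q * V = 0\<^sub>m k n"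
    unfolding Y V by (simp_all only: mat_norm d smult_add blocks smult_zero_mat)
  note N = necessity_blocks[OF cars(1-6) YV(1,2) P P' syms(1,2) YV(3) syms(3,4) inv
      meta_eq_to_obj_eq[OF T_def] meta_eq_to_obj_eq[OF S_def]]
  show "T\<^sup>T * P = four_block_mat (2 \<cdot>\<^sub>m 1\<^sub>m n) (0\<^sub>m n k) X U"
    and "S\<^sup>T * P = four_block_mat (0\<^sub>m n n) (0\<^sub>m n k) X U"
    and "T\<^sup>T * P * T + S\<^sup>T * P * S = 2 \<cdot>\<^sub>m bold_X n X Y"
    by (rule N)+
  have "sub_block 0 0 n n (P' * R) = X' * R1 + U' * R2"
    unfolding P' R by (simp only: mat_norm d sub_block_four_block)
  moreover have "sub_block 0 0 n n (- (R * P' * R)) =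
    - (R1 * (X' * R1 + U' * R2) + R2\<^sup>T * (U'\<^sup>T * R1 + Q' * R2))"
  proof -
    have "sub_block 0 0 n n (- (R * P' * R)) = - sub_block 0 0 n n (R * P' * R)"
      by (rule eq_matI) (use carrier_matD[OF car(2)] in \<open>simp_all add: sub_block_def del: index_mult_mat(1)\<close>)
    also have "sub_block 0 0 n n (R * P' * R) = 
      R1 * (X' * R1 + U' * R2) + R2\<^sup>T * (U'\<^sup>T * R1 + Q' * R2)"
      unfolding P' R
      by (simp only: mat_norm d sub_block_four_block, rule eq_matI)
        (auto simp: d simp del: index_mult_mat(1))
    finally show ?thesis .
  qed
  ultimately show "T\<^sup>T * P' * T + S\<^sup>T * P' * S = 2 \<cdot>\<^sub>m four_block_mat
      (- (2 \<cdot>\<^sub>m sub_block 0 0 n n (- (R * P' * R)))) ((sub_block 0 0 n n (P' * R))\<^sup>T)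
      (sub_block 0 0 n n (P' * R)) (sub_block 0 0 n n P')"
    unfolding N(4) X'_def[symmetric]
    by (simp only: Y V mat_norm d)
      (rule cong_four_block_mat; auto simp: d simp del: index_mult_mat(1) intro!: eq_matI)
  show "\<exists>L\<in>carrier_mat (n + n) (n + k). \<exists>L'\<in>carrier_mat (n + n) (n + k).
      L * T + L' * S = 1\<^sub>m (n + n)"
    by (rule bexI, rule bexI, rule N(5)) (rule carrier_matI; simp only: mat_dim_simps d)+
qed

text \<open>Half the lower left block of the congruence \<open>T\<^sup>T * P * Acl * T\<close>,
  where \<open>Acl\<close> is the closed-loop matrix: the sum of the two congruences is twice the
  bold \<open>A\<close>, but its \<open>S\<close> term contributes nothing to this block.\<close>

definition synthesis_K ::
  "real mat \<Rightarrow> real mat \<Rightarrow> real mat \<Rightarrow> real mat \<Rightarrow> real mat \<Rightarrow> real mat \<Rightarrow> real mat \<Rightarrow>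
   real mat \<Rightarrow> real mat \<Rightarrow> real mat \<Rightarrow> real mat \<Rightarrow> real mat" where
  "synthesis_K A B C X U Y V Ac Bc Cc Dc =
    (1/2) \<cdot>\<^sub>m ((X * (A + B * Dc * C) + U * (Bc * C)) * Y + (X * (B * Cc) + U * Ac) * V)"

lemma pos_def_bold_X_necessity:
  fixes P R :: "real mat"
  assumes car: "P \<in> carrier_mat (n + k) (n + k)" "R \<in> carrier_mat (n + k) (n + k)"
    and pd: "pos_def P" and PR: "P * R = 1\<^sub>m (n + k)"
  shows "pos_def (bold_X n (sub_block 0 0 n n P) (2 \<cdot>\<^sub>m sub_block 0 0 n n R))"
proof -
  note sym = pos_defD(1)[OF pd car(1)]
  note N = necessity_matrices[OF car car(1) sym sym PR]
  obtain L L' where L: "L \<in> carrier_mat (n + n) (n + k)" "L' \<in> carrier_mat (n + n) (n + k)"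
    and LT: "L * four_block_mat (2 \<cdot>\<^sub>m sub_block 0 0 n n R) (1\<^sub>m n) (2 \<cdot>\<^sub>m sub_block n 0 k n R) (0\<^sub>m k n) +
       L' * four_block_mat (0\<^sub>m n n) (1\<^sub>m n) (0\<^sub>m k n) (0\<^sub>m k n) = 1\<^sub>m (n + n)"
    using N(5) by blast
  note sb = carrier_matD[OF sub_block_carrier]
  have pd2: "pos_def (2 \<cdot>\<^sub>m bold_X n (sub_block 0 0 n n P) (2 \<cdot>\<^sub>m sub_block 0 0 n n R))"
    unfolding N(3)[symmetric]
    by (rule pos_def_congruence_sum[OF pd car(1) _ _ L LT])
      (rule carrier_matI; simp only: mat_dim_simps sb)+
  have bX: "bold_X n (sub_block 0 0 n n P) (2 \<cdot>\<^sub>m sub_block 0 0 n n R) \<in> carrier_mat (n + n) (n + n)"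
    unfolding bold_X_def by (rule carrier_matI; simp only: mat_dim_simps sb)
  show ?thesis by (rule pos_def_smultD[OF pd2 zero_less_numeral bX])
qed

text \<open>The two-term congruence is applied to minus the Lyapunov expression. Its derivative part
  has off-diagonal blocks coming from \<open>P' * R\<close>, which are absent from
  \<open>bold_Z\<close>; adding the leading block of \<open>P' * R\<close> to \<open>K\<close> moves
  them into \<open>bA\<close>.\<close>

lemma neg_def_flow_necessity:
  fixes P P' R A B C Ac Bc Cc Dc :: "real mat"
  assumes plant: "A \<in> carrier_mat n n" "B \<in> carrier_mat n m" "C \<in> carrier_mat q n"
    and ctrl: "Ac \<in> carrier_mat k k" "Bc \<in> carrier_mat k q" "Cc \<in> carrier_mat m k" "Dc \<in> carrier_mat m q"
    and car: "P \<in> carrier_mat (n + k) (n + k)" "R \<in> carrier_mat (n + k) (n + k)"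
      "P' \<in> carrier_mat (n + k) (n + k)"
    and sym: "P\<^sup>T = P" "P'\<^sup>T = P'" and PR: "P * R = 1\<^sub>m (n + k)"
    and nd: "neg_def (P' + (closed_loop A B C Ac Bc Cc Dc)\<^sup>T * P + P * closed_loop A B C Ac Bc Cc Dc)"
  defines "X \<equiv> sub_block 0 0 n n P" and "U \<equiv> sub_block 0 n n k P"
    and "Y \<equiv> 2 \<cdot>\<^sub>m sub_block 0 0 n n R" and "V \<equiv> 2 \<cdot>\<^sub>m sub_block n 0 k n R"
  defines "bA \<equiv> bold_A n m q A B C X Y
      (synthesis_K A B C X U Y V Ac Bc Cc Dc + sub_block 0 0 n n (P' * R))
      (X * (B * Dc) + U * Bc) (Dc * C * Y + Cc * V) Dc"
  shows "neg_def (bold_Z n (sub_block 0 0 n n P') (2 \<cdot>\<^sub>m sub_block 0 0 n n (- (R * P' * R))) + bA\<^sup>T + bA)"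
proof -
  define Acl where "Acl = closed_loop A B C Ac Bc Cc Dc"
  define F where "F = P' + Acl\<^sup>T * P + P * Acl"
  define T S where "T = four_block_mat Y (1\<^sub>m n) V (0\<^sub>m k n)"
    and "S = (four_block_mat (0\<^sub>m n n) (1\<^sub>m n) (0\<^sub>m k n) (0\<^sub>m k n) :: real mat)"
  define D where "D = sub_block 0 0 n n (P' * R)"
  define X' Y' where "X' = sub_block 0 0 n n P'" and "Y' = 2 \<cdot>\<^sub>m sub_block 0 0 n n (- (R * P' * R))"
  define bA0 where "bA0 = bold_A n m q A B C X Y (synthesis_K A B C X U Y V Ac Bc Cc Dc)
      (X * (B * Dc) + U * Bc) (Dc * C * Y + Cc * V) Dc"
  note bcar = sub_block_carrier
  have cars: "X \<in> carrier_mat n n" "U \<in> carrier_mat n k" "Y \<in> carrier_mat n n" "V \<in> carrier_mat k n"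
    "D \<in> carrier_mat n n" "X' \<in> carrier_mat n n" "Y' \<in> carrier_mat n n"
    unfolding X_def U_def Y_def V_def D_def X'_def Y'_def by (simp_all only: bcar smult_carrier_mat)
  note d = cars[THEN carrier_matD(1)] cars[THEN carrier_matD(2)]
    plant[THEN carrier_matD(1)] plant[THEN carrier_matD(2)]
    ctrl[THEN carrier_matD(1)] ctrl[THEN carrier_matD(2)]
    car[THEN carrier_matD(1)] car[THEN carrier_matD(2)]
  have TS: "T \<in> carrier_mat (n + k) (n + n)" "S \<in> carrier_mat (n + k) (n + n)"
    "Acl \<in> carrier_mat (n + k) (n + k)" "F \<in> carrier_mat (n + k) (n + k)"
    unfolding T_def S_def F_def Acl_def closed_loop_def
    by (rule carrier_matI; simp only: mat_dim_simps d)+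
  note d' = d TS[THEN carrier_matD(1)] TS[THEN carrier_matD(2)]
  note N = necessity_matrices[OF car sym PR, folded X_def U_def Y_def V_def,
      folded T_def S_def D_def X'_def Y'_def]
  have G: "T\<^sup>T * P * Acl * T + S\<^sup>T * P * Acl * S = 2 \<cdot>\<^sub>m bA0"
    unfolding Acl_def bA0_def synthesis_K_def
    by (rule bold_A_of_closed_loop[OF plant cars(1-4) ctrl N(1,2) T_def S_def])
  have bA0d: "dim_row bA0 = n + n" "dim_col bA0 = n + n"
    unfolding bA0_def by (rule bold_A_dim[OF plant(3) cars(1) plant(1)])+
  have bA: "bA = bA0 + four_block_mat (0\<^sub>m n n) (0\<^sub>m n n) D (0\<^sub>m n n)"
    unfolding bA_def bA0_def D_def[symmetric]
    by (rule bold_A_add_K[OF plant cars(1,3) _ _ _ ctrl(4) cars(5)])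
      (rule carrier_matI; simp only: synthesis_K_def mat_dim_simps d)+
  \<comment> \<open>Collects the \<open>T\<close> and \<open>S\<close> contributions to each of the
    three terms, to match \<open>N(4)\<close> and \<open>G\<close>.\<close>
  have split: "A1 + A2\<^sup>T + A2 + (B1 + B2\<^sup>T + B2) = (A1 + B1) + (A2 + B2)\<^sup>T + (A2 + B2)"
    if "A1 \<in> carrier_mat l l" "A2 \<in> carrier_mat l l" "B1 \<in> carrier_mat l l" "B2 \<in> carrier_mat l l"
    for A1 A2 B1 B2 :: "real mat" and l
    by (rule eq_matI) (use that[THEN carrier_matD(1)] that[THEN carrier_matD(2)] in auto)
  have car2: "T\<^sup>T * P' * T \<in> carrier_mat (n + n) (n + n)" "T\<^sup>T * P * Acl * T \<in> carrier_mat (n + n) (n + n)"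
    "S\<^sup>T * P' * S \<in> carrier_mat (n + n) (n + n)" "S\<^sup>T * P * Acl * S \<in> carrier_mat (n + n) (n + n)"
    by (rule carrier_matI; simp only: mat_dim_simps d')+
  have "T\<^sup>T * F * T + S\<^sup>T * F * S = 2 \<cdot>\<^sub>m four_block_mat (- Y') D\<^sup>T D X' + (2 \<cdot>\<^sub>m bA0)\<^sup>T + 2 \<cdot>\<^sub>m bA0"
    unfolding F_def flow_congruence[OF car(1,3) TS(3,1) sym(1)] flow_congruence[OF car(1,3) TS(3,2) sym(1)]
      split[OF car2] G N(4) by (rule refl)
  \<comment> \<open>The off-diagonal blocks \<open>D\<^sup>T\<close> and \<open>D\<close> are what
    \<open>bA\<^sup>T + bA\<close> contains beyond the terms of \<open>bA0\<close>.\<close>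
  also have "\<dots> = 2 \<cdot>\<^sub>m (bold_Z n X' Y' + bA\<^sup>T + bA)"
    unfolding bA bold_Z_def
    by (rule eq_matI) (auto simp: d bA0d distrib_left)
  finally have eq: "T\<^sup>T * F * T + S\<^sup>T * F * S = 2 \<cdot>\<^sub>m (bold_Z n X' Y' + bA\<^sup>T + bA)" .
  obtain L L' where L: "L \<in> carrier_mat (n + n) (n + k)" "L' \<in> carrier_mat (n + n) (n + k)"
    and LT: "L * T + L' * S = 1\<^sub>m (n + n)"
    using N(5) by blast
  have Z: "- (bold_Z n X' Y' + bA\<^sup>T + bA) \<in> carrier_mat (n + n) (n + n)"
    unfolding bA bold_Z_def by (rule carrier_matI; simp only: mat_dim_simps d bA0d)
  have F: "pos_def (- F)" "- F \<in> carrier_mat (n + k) (n + k)"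
    using nd TS(4) by (simp_all only: neg_def_iff_pos_def_uminus F_def Acl_def uminus_carrier_iff_mat)
  have "pos_def (T\<^sup>T * (- F) * T + S\<^sup>T * (- F) * S)"
    by (rule pos_def_congruence_sum[OF F TS(1,2) L LT])
  also have "T\<^sup>T * (- F) * T + S\<^sup>T * (- F) * S = - (T\<^sup>T * F * T + S\<^sup>T * F * S)"
    by (simp only: dim_mult_uminus dim_uminus_mult mat_dim_simps d', rule eq_matI)
      (auto simp: d' simp del: index_mult_mat(1))
  also have "\<dots> = 2 \<cdot>\<^sub>m (- (bold_Z n X' Y' + bA\<^sup>T + bA))"
    unfolding eq by (rule eq_matI) auto
  finally have pd2: "pos_def (2 \<cdot>\<^sub>m (- (bold_Z n X' Y' + bA\<^sup>T + bA)))" .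
  show ?thesis
    unfolding neg_def_iff_pos_def_uminus X'_def[symmetric] Y'_def[symmetric]
    by (rule pos_def_smultD[OF pd2 zero_less_numeral Z])
qed

text \<open>Once the jump inequality is in block form, it is transformed by
  \<open>diag(T, T0)\<close> and \<open>diag(S, S)\<close>, with \<open>T\<close> and
  \<open>T0\<close> built from the inverses of \<open>P\<close> and of \<open>P0\<close>. No
  derivative occurs here, so \<open>K\<close> needs no correction.\<close>

lemma pos_def_jump_necessity:
  fixes P P0 R R0 A B C Ac Bc Cc Dc :: "real mat"
  assumes plant: "A \<in> carrier_mat n n" "B \<in> carrier_mat n m" "C \<in> carrier_mat q n"
    and ctrl: "Ac \<in> carrier_mat k k" "Bc \<in> carrier_mat k q" "Cc \<in> carrier_mat m k" "Dc \<in> carrier_mat m q"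
    and car: "P \<in> carrier_mat (n + k) (n + k)" "R \<in> carrier_mat (n + k) (n + k)"
      "P0 \<in> carrier_mat (n + k) (n + k)" "R0 \<in> carrier_mat (n + k) (n + k)"
    and pd: "pos_def P" "pos_def P0" and PR: "P * R = 1\<^sub>m (n + k)" "P0 * R0 = 1\<^sub>m (n + k)"
    and nd: "neg_def ((closed_loop A B C Ac Bc Cc Dc)\<^sup>T * P0 * closed_loop A B C Ac Bc Cc Dc - P)"
  defines "X \<equiv> sub_block 0 0 n n P" and "X0 \<equiv> sub_block 0 0 n n P0" and "U0 \<equiv> sub_block 0 n n k P0"
    and "Y \<equiv> 2 \<cdot>\<^sub>m sub_block 0 0 n n R" and "V \<equiv> 2 \<cdot>\<^sub>m sub_block n 0 k n R"
    and "Y0 \<equiv> 2 \<cdot>\<^sub>m sub_block 0 0 n n R0"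
  defines "bA \<equiv> bold_A n m q A B C X0 Y (synthesis_K A B C X0 U0 Y V Ac Bc Cc Dc)
      (X0 * (B * Dc) + U0 * Bc) (Dc * C * Y + Cc * V) Dc"
  shows "pos_def (four_block_mat (bold_X n X Y) bA\<^sup>T bA (bold_X n X0 Y0))"
proof -
  define Acl where "Acl = closed_loop A B C Ac Bc Cc Dc"
  define V0 where "V0 = 2 \<cdot>\<^sub>m sub_block n 0 k n R0"
  define T T0 S where "T = four_block_mat Y (1\<^sub>m n) V (0\<^sub>m k n)"
    and "T0 = four_block_mat Y0 (1\<^sub>m n) V0 (0\<^sub>m k n)"
    and "S = (four_block_mat (0\<^sub>m n n) (1\<^sub>m n) (0\<^sub>m k n) (0\<^sub>m k n) :: real mat)"
  note bcar = sub_block_carrier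
  have cars: "X0 \<in> carrier_mat n n" "U0 \<in> carrier_mat n k" "Y \<in> carrier_mat n n" "V \<in> carrier_mat k n"
    "X \<in> carrier_mat n n" "Y0 \<in> carrier_mat n n" "V0 \<in> carrier_mat k n"
    unfolding X_def X0_def U0_def Y_def V_def Y0_def V0_def by (simp_all only: bcar smult_carrier_mat)
  note d = cars[THEN carrier_matD(1)] cars[THEN carrier_matD(2)]
    plant[THEN carrier_matD(1)] plant[THEN carrier_matD(2)]
    ctrl[THEN carrier_matD(1)] ctrl[THEN carrier_matD(2)]
    car[THEN carrier_matD(1)] car[THEN carrier_matD(2)]
  have TS: "T \<in> carrier_mat (n + k) (n + n)" "T0 \<in> carrier_mat (n + k) (n + n)"
    "S \<in> carrier_mat (n + k) (n + n)" "Acl \<in> carrier_mat (n + k) (n + k)"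
    unfolding T_def T0_def S_def Acl_def closed_loop_def
    by (rule carrier_matI; simp only: mat_dim_simps d)+
  note d' = d TS[THEN carrier_matD(1)] TS[THEN carrier_matD(2)]
  note sym = pos_defD(1)[OF pd(1) car(1)] and sym0 = pos_defD(1)[OF pd(2) car(3)]
  note N = necessity_matrices[OF car(1,2,1) sym sym PR(1), folded X_def Y_def V_def,
      folded T_def S_def]
  note N0 = necessity_matrices[OF car(3,4,3) sym0 sym0 PR(2), folded X0_def U0_def Y0_def V0_def,
      folded T0_def S_def]
  have G: "T0\<^sup>T * P0 * Acl * T + S\<^sup>T * P0 * Acl * S = 2 \<cdot>\<^sub>m bA"
    unfolding Acl_def bA_def synthesis_K_def
    by (rule bold_A_of_closed_loop[OF plant cars(1-4) ctrl N0(1,2) T_def S_def])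
  have bAd: "dim_row bA = n + n" "dim_col bA = n + n"
    unfolding bA_def by (rule bold_A_dim[OF plant(3) cars(1) plant(1)])+
  obtain L L' where L: "L \<in> carrier_mat (n + n) (n + k)" "L' \<in> carrier_mat (n + n) (n + k)"
    and LT: "L * T + L' * S = 1\<^sub>m (n + n)"
    using N(5) by blast
  obtain L0 L0' where L0: "L0 \<in> carrier_mat (n + n) (n + k)" "L0' \<in> carrier_mat (n + n) (n + k)"
    and LT0: "L0 * T0 + L0' * S = 1\<^sub>m (n + n)"
    using N0(5) by blast
  note dL = L[THEN carrier_matD(1)] L[THEN carrier_matD(2)] L0[THEN carrier_matD(1)] L0[THEN carrier_matD(2)]
  let ?diag = "\<lambda>M N. four_block_mat M (0\<^sub>m (n + k) (n + n)) (0\<^sub>m (n + k) (n + n)) N"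
  let ?diagL = "\<lambda>M N. four_block_mat M (0\<^sub>m (n + n) (n + k)) (0\<^sub>m (n + n) (n + k)) N"
  let ?big = "four_block_mat P (Acl\<^sup>T * P0) (P0 * Acl) P0"
  have "- (Acl\<^sup>T * P0 * Acl - P) = P - Acl\<^sup>T * P0 * Acl"
    by (rule eq_matI) (auto simp: d' simp del: index_mult_mat(1))
  then have big: "pos_def ?big"
    using nd pd(2) unfolding neg_def_iff_pos_def_uminus Acl_def[symmetric]
    by (simp only: pos_def_jump_block_iff[OF car(1,3) TS(4)])
  have bigc: "?big \<in> carrier_mat ((n + k) + (n + k)) ((n + k) + (n + k))"
    by (rule carrier_matI; simp only: mat_dim_simps d')
  \<comment> \<open>The left factors for \<open>(T, S)\<close> and for \<open>(T0, S)\<close>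
    combine block-diagonally.\<close>
  have LTbig: "?diagL L L0 * ?diag T T0 + ?diagL L' L0' * ?diag S S = 1\<^sub>m ((n + n) + (n + n))"
    unfolding four_block_one_mat[of "n + n" "n + n", symmetric]
    by (simp only: mat_block_simps dim_mult_zero dim_add_zero mat_dim_simps d' dL LT LT0)
  have sum: "pos_def ((?diag T T0)\<^sup>T * ?big * ?diag T T0 + (?diag S S)\<^sup>T * ?big * ?diag S S)"
    by (rule pos_def_congruence_sum[OF big bigc _ _ _ _ LTbig])
      (rule carrier_matI; simp only: mat_dim_simps d' dL)+
  have Gt: "(T0\<^sup>T * P0 * Acl * T)\<^sup>T + (S\<^sup>T * P0 * Acl * S)\<^sup>T = (2 \<cdot>\<^sub>m bA)\<^sup>T"
    unfolding G[symmetric] by (rule dim_transpose_add[symmetric]) (simp_all only: mat_dim_simps d')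
  have "(?diag T T0)\<^sup>T * ?big * ?diag T T0 + (?diag S S)\<^sup>T * ?big * ?diag S S =
      four_block_mat (2 \<cdot>\<^sub>m bold_X n X Y) ((2 \<cdot>\<^sub>m bA)\<^sup>T) (2 \<cdot>\<^sub>m bA) (2 \<cdot>\<^sub>m bold_X n X0 Y0)"
    unfolding jump_congruence[OF car(1,3) TS(4,1,2) sym0] jump_congruence[OF car(1,3) TS(4,3,3) sym0]
      N(3)[symmetric] N0(3)[symmetric] G[symmetric]
    unfolding Gt[unfolded G[symmetric], symmetric]
    by (rule dim_add_four_block) (simp_all only: mat_dim_simps d')
  also have "\<dots> = 2 \<cdot>\<^sub>m four_block_mat (bold_X n X Y) bA\<^sup>T bA (bold_X n X0 Y0)"
    unfolding dim_transpose_smult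
    by (rule dim_smult_four_block[symmetric]) (simp_all only: bold_X_def mat_dim_simps d bAd)
  finally have pd2: "pos_def (2 \<cdot>\<^sub>m four_block_mat (bold_X n X Y) bA\<^sup>T bA (bold_X n X0 Y0))"
    using sum by (simp only:)
  show ?thesis
    by (rule pos_def_smultD[OF pd2 zero_less_numeral, where n = "n + n + (n + n)"], rule carrier_matI)
      (simp_all only: bold_X_def mat_dim_simps d bAd)
qed

section \<open>Sufficiency: reconstruction of the controller and of its certificate\<close>

text \<open>Here the congruence matrix \<open>T\<close> is invertible; \<open>U = Y\<^sup>-\<^sup>1 - X\<close> and \<open>V = Y\<close> is one of the
  factorisations \<open>X Y + U V = I\<close> of the standard controller reconstruction.\<close>

lemma sufficiency_matrices:
  fixes X X' Y Y' W T P P' :: "real mat"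
  assumes car: "X \<in> carrier_mat n n" "X' \<in> carrier_mat n n" "Y \<in> carrier_mat n n"
      "Y' \<in> carrier_mat n n" "W \<in> carrier_mat n n"
    and sym: "Y\<^sup>T = Y" and inv: "Y * W = 1\<^sub>m n" "W * Y = 1\<^sub>m n"
    and T: "T = four_block_mat Y (1\<^sub>m n) Y (0\<^sub>m n n)"
    and P: "P = four_block_mat X (W - X) (W - X) (X - W)"
    and P': "P' = four_block_mat X' (- (W * Y' * W) - X') (- (W * Y' * W) - X') (X' - (- (W * Y' * W)))"
  shows "T\<^sup>T * P = four_block_mat (1\<^sub>m n) (0\<^sub>m n n) X (W - X)"
    and "T\<^sup>T * P * T = bold_X n X Y"
    and "T\<^sup>T * P' * T = four_block_mat (- Y') (- (Y' * W)) (- (W * Y')) X'"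
    and "T * four_block_mat (0\<^sub>m n n) W (1\<^sub>m n) (- (1\<^sub>m n)) = 1\<^sub>m (n + n)"
proof -
  note d = car[THEN carrier_matD(1)] car[THEN carrier_matD(2)]
  have inv': "Y * (W * Z) = Z" if "dim_row Z = n" for Z
    using that by (simp add: dim_mult_assoc[symmetric] d inv dim_mult_one)
  show TP: "T\<^sup>T * P = four_block_mat (1\<^sub>m n) (0\<^sub>m n n) X (W - X)"
    by (simp only: T P mat_norm d sym inv, rule cong_four_block_mat)
      (auto simp: d simp del: index_mult_mat(1) intro!: eq_matI)
  show "T\<^sup>T * P * T = bold_X n X Y"
    unfolding TP
    by (simp only: T bold_X_def mat_norm d inv, rule cong_four_block_mat)
      (auto simp: d simp del: index_mult_mat(1) intro!: eq_matI)
  show "T\<^sup>T * P' * T = four_block_mat (- Y') (- (Y' * W)) (- (W * Y')) X'"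
    by (simp only: T P' mat_norm d sym inv inv', rule cong_four_block_mat)
      (auto simp: d simp del: index_mult_mat(1) intro!: eq_matI)
  \<comment> \<open>With this explicit inverse, congruence with \<open>T\<close> becomes an
    equivalence.\<close>
  show "T * four_block_mat (0\<^sub>m n n) W (1\<^sub>m n) (- (1\<^sub>m n)) = 1\<^sub>m (n + n)"
    unfolding four_block_one_mat[of n n, symmetric]
    by (simp only: T mat_norm d inv, rule cong_four_block_mat)
      (auto simp: d simp del: index_mult_mat(1) intro!: eq_matI)
qed

text \<open>Test vectors padded with zeros see only the leading block. Applied to
  \<open>bold_X\<close>, this makes \<open>Y\<close> definite and hence invertible.\<close>

lemma pos_def_leading_block:
  fixes A :: "real mat"
  assumes car: "A \<in> carrier_mat n n" "B \<in> carrier_mat n k" "C \<in> carrier_mat k n" "D \<in> carrier_mat k k"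
    and pd: "pos_def (four_block_mat A B C D)"
  shows "pos_def A"
proof -
  note d = car[THEN carrier_matD(1)] car[THEN carrier_matD(2)]
  have M: "four_block_mat A B C D \<in> carrier_mat (n + k) (n + k)"
    by (rule four_block_carrier_mat[OF car(1,4)])
  show ?thesis
  proof (rule pos_defI[OF car(1)])
    have "(four_block_mat A B C D)\<^sup>T = four_block_mat A\<^sup>T C\<^sup>T B\<^sup>T D\<^sup>T"
      by (rule dim_transpose_four_block) (simp_all only: d)
    then have "four_block_mat A\<^sup>T C\<^sup>T B\<^sup>T D\<^sup>T = four_block_mat A B C D"
      by (simp only: pos_defD(1)[OF pd M])
    from arg_cong[OF this, of "sub_block 0 0 n n"] show "A\<^sup>T = A"
      by (simp only: sub_block_four_block d mat_dim_simps)
    fix v :: "real vec" assume v: "v \<in> carrier_vec n" "v \<noteq> 0\<^sub>v n"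
    have "v @\<^sub>v 0\<^sub>v k \<noteq> 0\<^sub>v (n + k)"
    proof
      assume "v @\<^sub>v 0\<^sub>v k = 0\<^sub>v (n + k)"
      also have "0\<^sub>v (n + k) = 0\<^sub>v n @\<^sub>v (0\<^sub>v k :: real vec)" by auto
      finally show False using v append_vec_eq[OF v(1) zero_carrier_vec] by auto
    qed
    then have "(v @\<^sub>v 0\<^sub>v k) \<bullet> (four_block_mat A B C D *\<^sub>v (v @\<^sub>v 0\<^sub>v k)) > 0"
      using v by (intro pos_defD(2)[OF pd M]) auto
    moreover have "B *\<^sub>v 0\<^sub>v k = 0\<^sub>v n"
      by (rule eq_vecI) (use d in \<open>auto simp: scalar_prod_def\<close>)
    ultimately show "v \<bullet> (A *\<^sub>v v) > 0"
      using v car by (simp add: four_block_mat_mult_vec[OF car] scalar_prod_append[of _ n _ k])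
  qed
qed

text \<open>\<open>X - W\<close> is the Schur complement of \<open>Y\<close> in
  \<open>bold_X\<close>. Its definiteness is what makes the coupling block \<open>W - X\<close> of
  the certificate invertible.\<close>

lemma pos_def_bold_XD:
  assumes car: "X \<in> carrier_mat n n" "Y \<in> carrier_mat n n" "W \<in> carrier_mat n n"
    and inv: "Y * W = 1\<^sub>m n" and pd: "pos_def (bold_X n X Y)"
  shows "pos_def (X - W)"
proof -
  note d = car[THEN carrier_matD(1)] car[THEN carrier_matD(2)]
  have Y: "pos_def Y"
    by (rule pos_def_leading_block[OF car(2) one_carrier_mat one_carrier_mat car(1) pd[unfolded bold_X_def]])
  have Wsym: "W\<^sup>T = W" and WY: "W * Y = 1\<^sub>m n"
    using inverse_transpose_sym[OF car(2) pos_defD(1)[OF Y car(2)] car(3) inv] by simp_all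
  \<comment> \<open>Block elimination with pivot \<open>Y\<close>, which clears both identity
    blocks.\<close>
  let ?T = "four_block_mat (1\<^sub>m n) (- W) (0\<^sub>m n n) (1\<^sub>m n)"
  let ?L = "four_block_mat (1\<^sub>m n) W (0\<^sub>m n n) (1\<^sub>m n)"
  have LT: "?L * ?T = 1\<^sub>m (n + n)"
    unfolding four_block_one_mat[of n n, symmetric]
    by (simp only: mat_norm d, rule cong_four_block_mat) (auto simp: d intro!: eq_matI)
  have "?T\<^sup>T * bold_X n X Y * ?T = four_block_mat Y (0\<^sub>m n n) (0\<^sub>m n n) (X - W)"
    by (simp only: bold_X_def mat_norm transpose_uminus Wsym WY inv d, rule cong_four_block_mat)
      (auto simp: d simp del: index_mult_mat(1) intro!: eq_matI)
  moreover have "pos_def (?T\<^sup>T * bold_X n X Y * ?T)"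
    by (rule pos_def_congruence[OF pd _ _ _ LT])
      (rule carrier_matI; simp only: bold_X_def mat_dim_simps d)+
  ultimately show ?thesis
    using pos_def_block_diag_iff[OF car(2) minus_carrier_mat[OF car(3)]] by simp
qed

text \<open>In the reconstruction formulas \<open>W\<close> stands for the inverse of
  \<open>Y\<close> and \<open>Ui\<close> for the inverse of \<open>W - X\<close>. They are separate
  arguments because at a jump \<open>X\<close> and \<open>Ui\<close> belong to clock value 0, but
  \<open>Y\<close> and \<open>W\<close> to the value before the impulse.\<close>

definition controller_A ::
  "real mat \<Rightarrow> real mat \<Rightarrow> real mat \<Rightarrow> real mat \<Rightarrow> real mat \<Rightarrow> real mat \<Rightarrow> real mat \<Rightarrow>
   real mat \<Rightarrow> real mat \<Rightarrow> real mat \<Rightarrow> real mat \<Rightarrow> real mat" where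
  "controller_A A B C X Y Ui W K L M N =
    Ui * (K - X * A * Y - X * B * M - (L - X * B * N) * C * Y) * W"

definition controller_B ::
  "real mat \<Rightarrow> real mat \<Rightarrow> real mat \<Rightarrow> real mat \<Rightarrow> real mat \<Rightarrow> real mat" where
  "controller_B B X Ui L N = Ui * (L - X * B * N)"

definition controller_C ::
  "real mat \<Rightarrow> real mat \<Rightarrow> real mat \<Rightarrow> real mat \<Rightarrow> real mat \<Rightarrow> real mat" where
  "controller_C C Y W M N = (M - N * C * Y) * W"

text \<open>The proposed certificate is congruent to \<open>bold_X\<close> by an invertible
  matrix.\<close>

lemma sufficiency_pos_def:
  assumes car: "X \<in> carrier_mat n n" "Y \<in> carrier_mat n n" "W \<in> carrier_mat n n"
    and sym: "Y\<^sup>T = Y" and inv: "Y * W = 1\<^sub>m n" "W * Y = 1\<^sub>m n"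
    and pd: "pos_def (bold_X n X Y)"
  shows "pos_def (four_block_mat X (W - X) (W - X) (X - W))"
proof -
  note d = car[THEN carrier_matD(1)] car[THEN carrier_matD(2)]
  note S = sufficiency_matrices[OF car(1,1,2,2,3) sym inv refl refl refl]
  show ?thesis
    by (rule pos_def_congruence_iff[THEN iffD1, OF _ _ _ S(4)])
      (simp_all only: S(2) pd, (rule carrier_matI; simp only: mat_dim_simps d)+)
qed

text \<open>\<open>P'\<close> is the derivative of \<open>P\<close>, with
  \<open>- (W * Y' * W)\<close> for the derivative of \<open>W\<close>. Its congruence has the
  off-diagonal blocks \<open>- (W * Y')\<close> and the transpose; building the controller from
  \<open>K + W * Y'\<close> cancels them and leaves exactly \<open>bold_Z\<close> with the given
  \<open>K\<close>.\<close>

lemma neg_def_flow_sufficiency: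
  fixes X X' Y Y' W Ui A B C K L M N P P' :: "real mat"
  assumes plant: "A \<in> carrier_mat n n" "B \<in> carrier_mat n m" "C \<in> carrier_mat q n"
    and KLMN: "K \<in> carrier_mat n n" "L \<in> carrier_mat n q" "M \<in> carrier_mat m n" "N \<in> carrier_mat m q"
    and car: "X \<in> carrier_mat n n" "X' \<in> carrier_mat n n" "Y \<in> carrier_mat n n"
      "Y' \<in> carrier_mat n n" "W \<in> carrier_mat n n" "Ui \<in> carrier_mat n n"
    and sym: "X\<^sup>T = X" "Y\<^sup>T = Y" "Y'\<^sup>T = Y'" and inv: "Y * W = 1\<^sub>m n" "W * Y = 1\<^sub>m n"
    and Ui: "(W - X) * Ui = 1\<^sub>m n"
    and P: "P = four_block_mat X (W - X) (W - X) (X - W)"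
    and P': "P' = four_block_mat X' (- (W * Y' * W) - X') (- (W * Y' * W) - X') (X' - (- (W * Y' * W)))"
    and nd: "neg_def (bold_Z n X' Y' + (bold_A n m q A B C X Y K L M N)\<^sup>T + bold_A n m q A B C X Y K L M N)"
  defines "Acl \<equiv> closed_loop A B C (controller_A A B C X Y Ui W (K + W * Y') L M N)
      (controller_B B X Ui L N) (controller_C C Y W M N) N"
  shows "neg_def (P' + Acl\<^sup>T * P + P * Acl)"
proof -
  note d = plant[THEN carrier_matD(1)] plant[THEN carrier_matD(2)]
    KLMN[THEN carrier_matD(1)] KLMN[THEN carrier_matD(2)] car[THEN carrier_matD(1)] car[THEN carrier_matD(2)]
  define T where "T = four_block_mat Y (1\<^sub>m n) Y (0\<^sub>m n n)"
  define bA where "bA = bold_A n m q A B C X Y K L M N"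
  note S = sufficiency_matrices[OF car(1-5) sym(2) inv T_def P P']
  have Wsym: "W\<^sup>T = W" by (rule inverse_transpose_sym(1)[OF car(3) sym(2) car(5) inv(1)])
  have cars: "P \<in> carrier_mat (n + n) (n + n)" "P' \<in> carrier_mat (n + n) (n + n)"
    "T \<in> carrier_mat (n + n) (n + n)" "Acl \<in> carrier_mat (n + n) (n + n)"
    unfolding P P' T_def Acl_def closed_loop_def controller_A_def controller_B_def controller_C_def
    by (rule carrier_matI; simp only: mat_dim_simps d)+
  note d' = d cars[THEN carrier_matD(1)] cars[THEN carrier_matD(2)]
  have Psym: "P\<^sup>T = P"
    unfolding P by (simp only: mat_norm d sym Wsym)
  have WY': "W * Y' \<in> carrier_mat n n" "K + W * Y' \<in> carrier_mat n n"
    by (rule carrier_matI; simp only: mat_dim_simps d)+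
  have G: "T\<^sup>T * P * Acl * T = bold_A n m q A B C X Y (K + W * Y') L M N"
    unfolding Acl_def controller_A_def controller_B_def controller_C_def
    by (rule bold_A_of_controller[OF plant car(1,3) _ car(6,5) WY'(2) KLMN(2-4) inv(2) Ui S(1) T_def])
      (rule carrier_matI; simp only: mat_dim_simps d)
  have bAd: "dim_row bA = n + n" "dim_col bA = n + n"
    unfolding bA_def by (rule bold_A_dim[OF plant(3) car(1) plant(1)])+
  have WYt: "Y' * W = (W * Y')\<^sup>T" by (simp only: mat_norm d sym Wsym)
  have eq: "T\<^sup>T * (P' + Acl\<^sup>T * P + P * Acl) * T = bold_Z n X' Y' + bA\<^sup>T + bA"
    unfolding flow_congruence[OF cars(1,2,4,3) Psym] G S(3)
      bold_A_add_K[OF plant car(1,3) KLMN WY'(1)] bA_def[symmetric] bold_Z_def WYt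
    by (rule eq_matI) (auto simp: d bAd simp del: index_mult_mat(1))
  have "- (T\<^sup>T * (P' + Acl\<^sup>T * P + P * Acl) * T) = T\<^sup>T * (- (P' + Acl\<^sup>T * P + P * Acl)) * T"
    by (simp only: dim_mult_uminus dim_uminus_mult mat_dim_simps d')
  then have "pos_def (T\<^sup>T * (- (P' + Acl\<^sup>T * P + P * Acl)) * T)"
    using nd by (simp only: neg_def_iff_pos_def_uminus bA_def[symmetric] eq)
  then show ?thesis
    unfolding neg_def_iff_pos_def_uminus
    by (rule pos_def_congruence_iff[THEN iffD1, OF _ _ _ S(4), rotated 3])
      (rule carrier_matI; simp only: mat_dim_simps d')+
qed

text \<open>The invertible congruence \<open>diag(T, T0)\<close> turns the block form of the jump
  inequality into the synthesis inequality. The controller maps into the state after the impulse, so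
  \<open>X0\<close> and the inverse of \<open>W0 - X0\<close> appear, while \<open>T\<close> undoes
  the coordinates before it through \<open>Y\<close> and \<open>W\<close>.\<close>

lemma neg_def_jump_sufficiency:
  fixes X X0 Y Y0 W W0 Ui A B C K L M N P P0 :: "real mat"
  assumes plant: "A \<in> carrier_mat n n" "B \<in> carrier_mat n m" "C \<in> carrier_mat q n"
    and KLMN: "K \<in> carrier_mat n n" "L \<in> carrier_mat n q" "M \<in> carrier_mat m n" "N \<in> carrier_mat m q"
    and car: "X \<in> carrier_mat n n" "X0 \<in> carrier_mat n n" "Y \<in> carrier_mat n n"
      "Y0 \<in> carrier_mat n n" "W \<in> carrier_mat n n" "W0 \<in> carrier_mat n n" "Ui \<in> carrier_mat n n"
    and sym: "X0\<^sup>T = X0" "Y\<^sup>T = Y" "Y0\<^sup>T = Y0"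
    and inv: "Y * W = 1\<^sub>m n" "W * Y = 1\<^sub>m n" "Y0 * W0 = 1\<^sub>m n" "W0 * Y0 = 1\<^sub>m n"
    and Ui: "(W0 - X0) * Ui = 1\<^sub>m n"
    and P: "P = four_block_mat X (W - X) (W - X) (X - W)"
    and P0: "P0 = four_block_mat X0 (W0 - X0) (W0 - X0) (X0 - W0)"
    and pd: "pos_def (four_block_mat (bold_X n X Y) ((bold_A n m q A B C X0 Y K L M N)\<^sup>T)
      (bold_A n m q A B C X0 Y K L M N) (bold_X n X0 Y0))"
  defines "Acl \<equiv> closed_loop A B C (controller_A A B C X0 Y Ui W K L M N)
      (controller_B B X0 Ui L N) (controller_C C Y W M N) N"
  shows "neg_def (Acl\<^sup>T * P0 * Acl - P)"
proof -
  note d = plant[THEN carrier_matD(1)] plant[THEN carrier_matD(2)]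
    KLMN[THEN carrier_matD(1)] KLMN[THEN carrier_matD(2)] car[THEN carrier_matD(1)] car[THEN carrier_matD(2)]
  define T T0 where "T = four_block_mat Y (1\<^sub>m n) Y (0\<^sub>m n n)"
    and "T0 = four_block_mat Y0 (1\<^sub>m n) Y0 (0\<^sub>m n n)"
  note S = sufficiency_matrices[OF car(1,1,3,3,5) sym(2) inv(1,2) T_def P refl]
  note S0 = sufficiency_matrices[OF car(2,2,4,4,6) sym(3) inv(3,4) T0_def P0 refl]
  have W0sym: "W0\<^sup>T = W0" by (rule inverse_transpose_sym(1)[OF car(4) sym(3) car(6) inv(3)])
  have cars: "P \<in> carrier_mat (n + n) (n + n)" "P0 \<in> carrier_mat (n + n) (n + n)"
    "T \<in> carrier_mat (n + n) (n + n)" "T0 \<in> carrier_mat (n + n) (n + n)"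
    "Acl \<in> carrier_mat (n + n) (n + n)"
    unfolding P P0 T_def T0_def Acl_def closed_loop_def controller_A_def controller_B_def controller_C_def
    by (rule carrier_matI; simp only: mat_dim_simps d)+
  note d' = d cars[THEN carrier_matD(1)] cars[THEN carrier_matD(2)]
  have P0sym: "P0\<^sup>T = P0"
    unfolding P0 by (simp only: mat_norm d sym W0sym)
  have G: "T0\<^sup>T * P0 * Acl * T = bold_A n m q A B C X0 Y K L M N"
    unfolding Acl_def controller_A_def controller_B_def controller_C_def
    by (rule bold_A_of_controller[OF plant car(2,3) _ car(7,5) KLMN inv(2) Ui S0(1) T_def])
      (rule carrier_matI; simp only: mat_dim_simps d)
  let ?diag = "\<lambda>M N. four_block_mat M (0\<^sub>m (n + n) (n + n)) (0\<^sub>m (n + n) (n + n)) N"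
  let ?big = "four_block_mat P (Acl\<^sup>T * P0) (P0 * Acl) P0"
  let ?Ti = "\<lambda>W. four_block_mat (0\<^sub>m n n) W (1\<^sub>m n) (- (1\<^sub>m n))"
  have TL: "?diag T T0 * ?diag (?Ti W) (?Ti W0) = 1\<^sub>m ((n + n) + (n + n))"
    unfolding four_block_one_mat[of "n + n" "n + n", symmetric]
    by (subst dim_mult_four_block)
      (simp_all only: S(4) S0(4) dim_mult_zero dim_add_zero mat_dim_simps d')
  have "pos_def ((?diag T T0)\<^sup>T * ?big * ?diag T T0)"
    unfolding jump_congruence[OF cars(1,2,5,3,4) P0sym] G S(2) S0(2) by (rule pd)
  then have "pos_def ?big"
    by (rule pos_def_congruence_iff[THEN iffD1, OF _ _ _ TL, rotated 3])
      (rule carrier_matI; simp only: mat_dim_simps d')+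
  then have "pos_def (P - Acl\<^sup>T * P0 * Acl)"
    by (simp only: pos_def_jump_block_iff[OF cars(1,2,5)])
  also have "P - Acl\<^sup>T * P0 * Acl = - (Acl\<^sup>T * P0 * Acl - P)"
    by (rule eq_matI) (auto simp: d' simp del: index_mult_mat(1))
  finally show ?thesis unfolding neg_def_iff_pos_def_uminus .
qed

subsection \<open>Continuity and derivatives of matrix-valued maps\<close>

lemma continuous_mat_onD:
  assumes "continuous_mat_on S nr nc F"
  shows "t \<in> S \<Longrightarrow> F t \<in> carrier_mat nr nc" "t \<in> S \<Longrightarrow> dim_row (F t) = nr"
    "t \<in> S \<Longrightarrow> dim_col (F t) = nc"
    "i < nr \<Longrightarrow> j < nc \<Longrightarrow> continuous_on S (\<lambda>t. F t $$ (i, j))"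
  using assms by (auto simp: continuous_mat_on_def)

text \<open>The separate entry function \<open>f\<close> has to agree with \<open>F\<close> only on
  \<open>S\<close>, where the dimensions needed to expand the entries of \<open>F\<close> are
  known.\<close>

lemma continuous_mat_onI:
  assumes "\<And>t. t \<in> S \<Longrightarrow> dim_row (F t) = nr" "\<And>t. t \<in> S \<Longrightarrow> dim_col (F t) = nc"
    and "\<And>i j. i < nr \<Longrightarrow> j < nc \<Longrightarrow> continuous_on S (\<lambda>t. f t i j)"
    and "\<And>t i j. t \<in> S \<Longrightarrow> i < nr \<Longrightarrow> j < nc \<Longrightarrow> F t $$ (i, j) = f t i j"
  shows "continuous_mat_on S nr nc F"
  unfolding continuous_mat_on_def
proof (intro conjI ballI allI impI)
  show "F t \<in> carrier_mat nr nc" if "t \<in> S" for t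
    using assms(1,2) that by (intro carrier_matI) auto
  show "continuous_on S (\<lambda>t. F t $$ (i, j))" if "i < nr" "j < nc" for i j
    using assms(3)[OF that] assms(4)[OF _ that] by (simp cong: continuous_on_cong)
qed

lemma continuous_mat_on_const: "A \<in> carrier_mat nr nc \<Longrightarrow> continuous_mat_on S nr nc (\<lambda>_. A)"
  by (auto simp: continuous_mat_on_def)

lemma continuous_mat_on_subset:
  "continuous_mat_on S nr nc F \<Longrightarrow> T \<subseteq> S \<Longrightarrow> continuous_mat_on T nr nc F"
  unfolding continuous_mat_on_def by (meson continuous_on_subset subsetD)

lemma continuous_mat_on_add:
  assumes "continuous_mat_on S nr nc F" "continuous_mat_on S nr nc G"
  shows "continuous_mat_on S nr nc (\<lambda>t. F t + G t)"
  by (rule continuous_mat_onI[where f = "\<lambda>t i j. F t $$ (i, j) + G t $$ (i, j)"])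
    (auto simp: continuous_mat_onD[OF assms(1)] continuous_mat_onD[OF assms(2)]
      intro!: continuous_intros)

lemma continuous_mat_on_minus:
  assumes "continuous_mat_on S nr nc F" "continuous_mat_on S nr nc G"
  shows "continuous_mat_on S nr nc (\<lambda>t. F t - G t)"
  by (rule continuous_mat_onI[where f = "\<lambda>t i j. F t $$ (i, j) - G t $$ (i, j)"])
    (auto simp: continuous_mat_onD[OF assms(1)] continuous_mat_onD[OF assms(2)]
      intro!: continuous_intros)

lemma continuous_mat_on_uminus:
  assumes "continuous_mat_on S nr nc F"
  shows "continuous_mat_on S nr nc (\<lambda>t. - F t)"
  by (rule continuous_mat_onI[where f = "\<lambda>t i j. - (F t $$ (i, j))"])
    (auto simp: continuous_mat_onD[OF assms] intro!: continuous_intros)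

lemma continuous_mat_on_smult:
  assumes "continuous_mat_on S nr nc F" "continuous_on S c"
  shows "continuous_mat_on S nr nc (\<lambda>t. c t \<cdot>\<^sub>m F t)"
  by (rule continuous_mat_onI[where f = "\<lambda>t i j. c t * F t $$ (i, j)"])
    (auto simp: continuous_mat_onD[OF assms(1)] intro!: continuous_intros assms(2))

lemma continuous_mat_on_mult:
  assumes "continuous_mat_on S nr n F" "continuous_mat_on S n nc G"
  shows "continuous_mat_on S nr nc (\<lambda>t. F t * G t)"
  by (rule continuous_mat_onI[where f = "\<lambda>t i j. \<Sum>l = 0..<n. F t $$ (i, l) * G t $$ (l, j)"])
    (auto simp: continuous_mat_onD[OF assms(1)] continuous_mat_onD[OF assms(2)] scalar_prod_def
      intro!: continuous_intros)

lemma continuous_mat_on_four_block: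
  assumes "continuous_mat_on S n1 k1 F" "continuous_mat_on S n1 k2 G"
    "continuous_mat_on S n2 k1 H" "continuous_mat_on S n2 k2 J"
  shows "continuous_mat_on S (n1 + n2) (k1 + k2) (\<lambda>t. four_block_mat (F t) (G t) (H t) (J t))"
proof (rule continuous_mat_onI[where f = "\<lambda>t i j. if i < n1
      then if j < k1 then F t $$ (i, j) else G t $$ (i, j - k1)
      else if j < k1 then H t $$ (i - n1, j) else J t $$ (i - n1, j - k1)"])
  fix i j assume "i < n1 + n2" "j < k1 + k2"
  then show "continuous_on S (\<lambda>t. if i < n1
      then if j < k1 then F t $$ (i, j) else G t $$ (i, j - k1)
      else if j < k1 then H t $$ (i - n1, j) else J t $$ (i - n1, j - k1))"
    by (cases "i < n1"; cases "j < k1") (auto intro!: assms[THEN continuous_mat_onD(4)])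
qed (auto simp: assms[THEN continuous_mat_onD(2)] assms[THEN continuous_mat_onD(3)])

lemma continuous_mat_on_sub_block:
  assumes "continuous_mat_on S nr nc F" "r + h \<le> nr" "c + w \<le> nc"
  shows "continuous_mat_on S h w (\<lambda>t. sub_block r c h w (F t))"
  by (rule continuous_mat_onI[where f = "\<lambda>t i j. F t $$ (r + i, c + j)"])
    (use assms(2,3) in \<open>auto simp: sub_block_def intro!: continuous_mat_onD(4)[OF assms(1)]\<close>)

section \<open>Continuity of determinants and inverses\<close>

lemma continuous_on_det:
  assumes F: "continuous_mat_on S n n F"
  shows "continuous_on S (\<lambda>t. det (F t))"
proof -
  have "continuous_on S (\<lambda>t. \<Sum>p\<in>{p. p permutes {0..<n}}. signof p * (\<Prod>i = 0..<n. F t $$ (i, p i)))"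
    by (intro continuous_intros continuous_mat_onD(4)[OF F]) (auto simp: permutes_in_image)
  moreover have "det (F t) = (\<Sum>p\<in>{p. p permutes {0..<n}}. signof p * (\<Prod>i = 0..<n. F t $$ (i, p i)))"
    if "t \<in> S" for t
    by (rule det_def'[OF continuous_mat_onD(1)[OF F that]])
  ultimately show ?thesis by (simp cong: continuous_on_cong)
qed

text \<open>Entries of the adjugate are signed minors, so continuity of determinants
  applies.\<close>

lemma continuous_mat_on_adj_mat:
  assumes F: "continuous_mat_on S n n F"
  shows "continuous_mat_on S n n (\<lambda>t. adj_mat (F t))"
proof (rule continuous_mat_onI[where f = "\<lambda>t i j. cofactor (F t) j i"])
  fix i j assume ij: "i < n" "j < n"
  \<comment> \<open>The adjugate is the transposed cofactor matrix, hence row \<open>j\<close> and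
    column \<open>i\<close> are deleted. Later indices move up by one.\<close>
  have "continuous_mat_on S (n - 1) (n - 1) (\<lambda>t. mat_delete (F t) j i)"
  proof (rule continuous_mat_onI[where f = "\<lambda>t i' j'.
        F t $$ (if i' < j then i' else Suc i', if j' < i then j' else Suc j')"])
    fix i' j' assume "i' < n - 1" "j' < n - 1"
    then show "continuous_on S (\<lambda>t. F t $$ (if i' < j then i' else Suc i', if j' < i then j' else Suc j'))"
      by (intro continuous_mat_onD(4)[OF F]) auto
  qed (auto simp: mat_delete_def continuous_mat_onD[OF F])
  then show "continuous_on S (\<lambda>t. cofactor (F t) j i)"
    unfolding cofactor_def by (intro continuous_intros continuous_on_det)
qed (auto simp: adj_mat_def continuous_mat_onD[OF F])

text \<open>The adjugate formula shows directly that the inverse depends continuously on the matrix.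
  The value is an inverse only where the determinant is nonzero.\<close>

definition mat_inv :: "real mat \<Rightarrow> real mat" where
  "mat_inv A = (1 / det A) \<cdot>\<^sub>m adj_mat A"

lemma mat_inv:
  assumes A: "A \<in> carrier_mat n n" and det: "det A \<noteq> 0"
  shows "mat_inv A \<in> carrier_mat n n" "A * mat_inv A = 1\<^sub>m n" "mat_inv A * A = 1\<^sub>m n"
proof -
  note adj = adj_mat[OF A]
  show "mat_inv A \<in> carrier_mat n n" using adj(1) by (simp add: mat_inv_def)
  have one: "(1 / det A) \<cdot>\<^sub>m (det A \<cdot>\<^sub>m 1\<^sub>m n) = 1\<^sub>m n"
    by (rule eq_matI) (use det in auto)
  show "A * mat_inv A = 1\<^sub>m n" "mat_inv A * A = 1\<^sub>m n"
    using carrier_matD[OF A] carrier_matD[OF adj(1)]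
    by (simp_all only: mat_inv_def dim_mult_smult dim_smult_mult adj one)
qed

lemma continuous_mat_on_mat_inv:
  assumes "continuous_mat_on S n n F" "\<And>t. t \<in> S \<Longrightarrow> det (F t) \<noteq> 0"
  shows "continuous_mat_on S n n (\<lambda>t. mat_inv (F t))"
  unfolding mat_inv_def
  by (intro continuous_mat_on_smult continuous_mat_on_adj_mat continuous_intros continuous_on_det)
    (use assms in auto)

text \<open>A nonzero kernel vector would give the form the value 0.\<close>

lemma pos_def_det_nonzero:
  assumes pd: "pos_def P" and P: "P \<in> carrier_mat n n"
  shows "det P \<noteq> 0"
proof
  assume "det P = 0"
  then obtain v where "v \<in> carrier_vec n" "v \<noteq> 0\<^sub>v n" "P *\<^sub>v v = 0\<^sub>v n"
    using det_0_iff_vec_prod_zero_field[OF P] by auto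
  with pos_defD(2)[OF pd P, of v] show False by simp
qed

section \<open>Derivatives of matrix-valued maps\<close>

text \<open>A relation with an explicit derivative supports calculus rules without the definite
  description inside \<open>mat_deriv\<close>. The two notions are connected on intervals
  below.\<close>

definition has_mat_deriv ::
  "real set \<Rightarrow> nat \<Rightarrow> nat \<Rightarrow> (real \<Rightarrow> real mat) \<Rightarrow> (real \<Rightarrow> real mat) \<Rightarrow> bool" where
  "has_mat_deriv S nr nc F F' \<longleftrightarrow> (\<forall>t\<in>S. F t \<in> carrier_mat nr nc \<and> F' t \<in> carrier_mat nr nc \<and>
     (\<forall>i<nr. \<forall>j<nc. ((\<lambda>s. F s $$ (i, j)) has_real_derivative F' t $$ (i, j)) (at t within S)))"

lemma has_mat_derivD:
  assumes "has_mat_deriv S nr nc F F'" "t \<in> S"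
  shows "F t \<in> carrier_mat nr nc" "F' t \<in> carrier_mat nr nc"
    "dim_row (F t) = nr" "dim_col (F t) = nc" "dim_row (F' t) = nr" "dim_col (F' t) = nc"
    "i < nr \<Longrightarrow> j < nc \<Longrightarrow> ((\<lambda>s. F s $$ (i, j)) has_real_derivative F' t $$ (i, j)) (at t within S)"
  using assms by (auto simp: has_mat_deriv_def)

lemma has_mat_derivI:
  assumes dims: "\<And>t. t \<in> S \<Longrightarrow> dim_row (F t) = nr" "\<And>t. t \<in> S \<Longrightarrow> dim_col (F t) = nc"
    "\<And>t. t \<in> S \<Longrightarrow> dim_row (F' t) = nr" "\<And>t. t \<in> S \<Longrightarrow> dim_col (F' t) = nc"
    and f: "\<And>t i j. t \<in> S \<Longrightarrow> i < nr \<Longrightarrow> j < nc \<Longrightarrow> F t $$ (i, j) = f i j t"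
    and f': "\<And>t i j. t \<in> S \<Longrightarrow> i < nr \<Longrightarrow> j < nc \<Longrightarrow> F' t $$ (i, j) = f' i j t"
    and der: "\<And>t i j. t \<in> S \<Longrightarrow> i < nr \<Longrightarrow> j < nc \<Longrightarrow>
      (f i j has_real_derivative f' i j t) (at t within S)"
  shows "has_mat_deriv S nr nc F F'"
  unfolding has_mat_deriv_def
proof (intro ballI conjI allI impI)
  fix t assume t: "t \<in> S"
  show "F t \<in> carrier_mat nr nc" "F' t \<in> carrier_mat nr nc"
    using dims t by (intro carrier_matI; simp)+
  fix i j assume ij: "i < nr" "j < nc"
  show "((\<lambda>s. F s $$ (i, j)) has_real_derivative F' t $$ (i, j)) (at t within S)"
    using der[OF t ij] unfolding f'[OF t ij] has_field_derivative_def
    by (rule has_derivative_transform[OF t f[OF _ ij], rotated])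
qed

lemma has_mat_deriv_minus:
  assumes "has_mat_deriv S nr nc F F'" "has_mat_deriv S nr nc G G'"
  shows "has_mat_deriv S nr nc (\<lambda>t. F t - G t) (\<lambda>t. F' t - G' t)"
  by (rule has_mat_derivI[where f = "\<lambda>i j t. F t $$ (i, j) - G t $$ (i, j)" and
        f' = "\<lambda>i j t. F' t $$ (i, j) - G' t $$ (i, j)"])
    (auto simp: has_mat_derivD[OF assms(1)] has_mat_derivD[OF assms(2)] intro!: derivative_intros)

lemma has_mat_deriv_smult:
  assumes "has_mat_deriv S nr nc F F'"
  shows "has_mat_deriv S nr nc (\<lambda>t. c \<cdot>\<^sub>m F t) (\<lambda>t. c \<cdot>\<^sub>m F' t)"
  by (rule has_mat_derivI[where f = "\<lambda>i j t. c * F t $$ (i, j)" and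
        f' = "\<lambda>i j t. c * F' t $$ (i, j)"])
    (auto simp: has_mat_derivD[OF assms(1)] intro!: DERIV_cmult)

lemma has_mat_deriv_sub_block:
  assumes "has_mat_deriv S nr nc F F'" "r + h \<le> nr" "c + w \<le> nc"
  shows "has_mat_deriv S h w (\<lambda>t. sub_block r c h w (F t)) (\<lambda>t. sub_block r c h w (F' t))"
  by (rule has_mat_derivI[where f = "\<lambda>i j t. F t $$ (r + i, c + j)" and
        f' = "\<lambda>i j t. F' t $$ (r + i, c + j)"])
    (use assms(2,3) in \<open>auto simp: sub_block_def intro!: has_mat_derivD(7)[OF assms(1)]\<close>)

lemma has_mat_deriv_four_block:
  assumes F: "has_mat_deriv S n1 k1 F F'" and G: "has_mat_deriv S n1 k2 G G'"
    and H: "has_mat_deriv S n2 k1 H H'" and J: "has_mat_deriv S n2 k2 J J'"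
  shows "has_mat_deriv S (n1 + n2) (k1 + k2) (\<lambda>t. four_block_mat (F t) (G t) (H t) (J t))
    (\<lambda>t. four_block_mat (F' t) (G' t) (H' t) (J' t))"
  by (rule has_mat_derivI[where
      f = "\<lambda>i j. if i < n1
      then if j < k1 then (\<lambda>t. F t $$ (i, j)) else (\<lambda>t. G t $$ (i, j - k1))
      else if j < k1 then (\<lambda>t. H t $$ (i - n1, j)) else (\<lambda>t. J t $$ (i - n1, j - k1))" and
      f' = "\<lambda>i j. if i < n1
      then if j < k1 then (\<lambda>t. F' t $$ (i, j)) else (\<lambda>t. G' t $$ (i, j - k1))
      else if j < k1 then (\<lambda>t. H' t $$ (i - n1, j)) else (\<lambda>t. J' t $$ (i - n1, j - k1))"])
    (auto simp: has_mat_derivD(3-6)[OF F] has_mat_derivD(3-6)[OF G] has_mat_derivD(3-6)[OF H]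
      has_mat_derivD(3-6)[OF J] intro!: has_mat_derivD(7)[OF F] has_mat_derivD(7)[OF G]
      has_mat_derivD(7)[OF H] has_mat_derivD(7)[OF J])

lemma mult_mult_entry:
  fixes A B C :: "real mat"
  assumes "A \<in> carrier_mat n n" "B \<in> carrier_mat n n" "C \<in> carrier_mat n n" "i < n" "j < n"
  shows "(A * B * C) $$ (i, j) = (\<Sum>l = 0..<n. (\<Sum>k = 0..<n. A $$ (i, k) * B $$ (k, l)) * C $$ (l, j))"
  using assms(1-3)[THEN carrier_matD(1)] assms(1-3)[THEN carrier_matD(2)] assms(4,5)
  by (simp add: scalar_prod_def)

text \<open>Since \<open>R(s) - R(t) = - R(s) (P(s) - P(t)) R(t)\<close>, continuity of the inverse suffices for
  its differentiability.\<close>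

lemma has_mat_deriv_inverse:
  assumes P: "has_mat_deriv S n n P P'" and R: "continuous_mat_on S n n R"
    and inv: "\<And>t. t \<in> S \<Longrightarrow> P t * R t = 1\<^sub>m n" "\<And>t. t \<in> S \<Longrightarrow> R t * P t = 1\<^sub>m n"
  shows "has_mat_deriv S n n R (\<lambda>t. - (R t * P' t * R t))"
proof (rule has_mat_derivI[where f = "\<lambda>i j t. R t $$ (i, j)" and
      f' = "\<lambda>i j t. - (\<Sum>l = 0..<n. (\<Sum>k = 0..<n. R t $$ (i, k) * P' t $$ (k, l)) * R t $$ (l, j))"])
  note d = continuous_mat_onD(2,3)[OF R] has_mat_derivD(3-6)[OF P]
  fix t i j assume t: "t \<in> S" and ij: "i < n" "j < n"
  show "(- (R t * P' t * R t)) $$ (i, j) =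
      - (\<Sum>l = 0..<n. (\<Sum>k = 0..<n. R t $$ (i, k) * P' t $$ (k, l)) * R t $$ (l, j))"
    using mult_mult_entry[OF continuous_mat_onD(1)[OF R t] has_mat_derivD(2)[OF P t]
        continuous_mat_onD(1)[OF R t] ij] ij d t by (simp del: index_mult_mat(1))
  \<comment> \<open>The identity also holds at \<open>s = t\<close>, where division by zero makes
    both sides 0.\<close>
  have quot: "(R s $$ (i, j) - R t $$ (i, j)) / (s - t) =
      - (\<Sum>l = 0..<n. (\<Sum>k = 0..<n. R s $$ (i, k) * ((P s $$ (k, l) - P t $$ (k, l)) / (s - t))) * R t $$ (l, j))"
    if s: "s \<in> S" for s
  proof -
    have "R s * (P s - P t) * R t = (R s * P s) * R t - R s * (P t * R t)"
      by (simp only: mat_ring_simps mat_dim_simps d[OF s] d[OF t])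
    also have "\<dots> = R t - R s"
      by (simp only: inv[OF s] inv[OF t] d[OF s] d[OF t] dim_mult_one)
    finally have "R s $$ (i, j) - R t $$ (i, j) = - ((R s * (P s - P t) * R t) $$ (i, j))"
      using d[OF s] d[OF t] ij by simp
    also have "(R s * (P s - P t) * R t) $$ (i, j) =
        (\<Sum>l = 0..<n. (\<Sum>k = 0..<n. R s $$ (i, k) * (P s $$ (k, l) - P t $$ (k, l))) * R t $$ (l, j))"
      by (subst mult_mult_entry[OF continuous_mat_onD(1)[OF R s] minus_carrier_mat[OF has_mat_derivD(1)[OF P t]]
            continuous_mat_onD(1)[OF R t] ij])
         (auto simp: d[OF s] d[OF t] intro!: sum.cong)
    finally show ?thesis
      by (simp add: sum_divide_distrib[symmetric])
  qed
  \<comment> \<open>Only here is continuity of the inverse used. The difference quotients of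
    \<open>P\<close> supply the rest of the limit.\<close>
  have R_lim: "((\<lambda>s. R s $$ (i, k)) \<longlongrightarrow> R t $$ (i, k)) (at t within S)" if "k < n" for k
    using continuous_mat_onD(4)[OF R ij(1) that] t by (simp add: continuous_on_def)
  have P_lim: "((\<lambda>s. (P s $$ (k, l) - P t $$ (k, l)) / (s - t)) \<longlongrightarrow> P' t $$ (k, l)) (at t within S)"
    if "k < n" "l < n" for k l
    using has_mat_derivD(7)[OF P t that] by (simp add: has_field_derivative_iff)
  have "((\<lambda>s. - (\<Sum>l = 0..<n. (\<Sum>k = 0..<n. R s $$ (i, k) * ((P s $$ (k, l) - P t $$ (k, l)) / (s - t))) * R t $$ (l, j)))
    \<longlongrightarrow> - (\<Sum>l = 0..<n. (\<Sum>k = 0..<n. R t $$ (i, k) * P' t $$ (k, l)) * R t $$ (l, j))) (at t within S)"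
    by (intro tendsto_intros R_lim P_lim) auto
  moreover have "\<forall>\<^sub>F s in at t within S. (R s $$ (i, j) - R t $$ (i, j)) / (s - t) =
      - (\<Sum>l = 0..<n. (\<Sum>k = 0..<n. R s $$ (i, k) * ((P s $$ (k, l) - P t $$ (k, l)) / (s - t))) * R t $$ (l, j))"
    unfolding eventually_at_filter using quot by simp
  ultimately show "((\<lambda>t. R t $$ (i, j)) has_real_derivative
      - (\<Sum>l = 0..<n. (\<Sum>k = 0..<n. R t $$ (i, k) * P' t $$ (k, l)) * R t $$ (l, j))) (at t within S)"
    unfolding has_field_derivative_iff by (simp only: tendsto_cong)
qed (use continuous_mat_onD(2,3)[OF R] in auto)

text \<open>As the interval is nondegenerate, each of its points, end points included, is a limit
  point of it, so limits of difference quotients are unique.\<close>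

lemma has_real_derivative_unique_Icc:
  fixes a b :: real
  assumes "a < b" "t \<in> {a..b}" "(f has_real_derivative D) (at t within {a..b})"
    "(f has_real_derivative D') (at t within {a..b})"
  shows "D = D'"
proof -
  have "at t within {a..b} \<noteq> bot"
  proof -
    consider "t = a" | "t = b" | "a < t" "t < b" using assms(2) by force
    then show ?thesis
      using assms(1)
      by cases (simp_all add: at_within_Icc_at_right at_within_Icc_at_left at_within_Icc_at)
  qed
  then show ?thesis
    using assms(3,4) unfolding has_field_derivative_iff by (rule tendsto_unique)
qed

lemma has_mat_deriv_continuous:
  assumes "has_mat_deriv S nr nc F F'"
  shows "continuous_mat_on S nr nc F"
  unfolding continuous_mat_on_def
  using has_mat_derivD[OF assms] by (auto intro!: DERIV_continuous_on)

text \<open>Entries \<open>(i, j)\<close> and \<open>(j, i)\<close> agree on the whole interval and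
  hence have the same unique derivative.\<close>

lemma has_mat_deriv_transpose:
  assumes ab: "a < b" and P: "has_mat_deriv {a..b} n n P P'"
    and sym: "\<And>t. t \<in> {a..b} \<Longrightarrow> (P t)\<^sup>T = P t" and t: "t \<in> {a..b}"
  shows "(P' t)\<^sup>T = P' t"
proof (rule eq_matI)
  note d = has_mat_derivD(3-6)[OF P]
  fix i j assume "i < dim_row (P' t)" "j < dim_col (P' t)"
  then have ij: "i < n" "j < n" using d[OF t] by auto
  have "P s $$ (j, i) = P s $$ (i, j)" if "s \<in> {a..b}" for s
    using arg_cong[OF sym[OF that], of "\<lambda>M. M $$ (i, j)"] d[OF that] ij by simp
  then have "((\<lambda>s. P s $$ (i, j)) has_real_derivative P' t $$ (j, i)) (at t within {a..b})"
    using has_mat_derivD(7)[OF P t ij(2,1)] unfolding has_field_derivative_def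
    by (intro has_derivative_transform[OF t, of "\<lambda>s. P s $$ (i, j)" "\<lambda>s. P s $$ (j, i)"]) auto
  from has_real_derivative_unique_Icc[OF ab t this has_mat_derivD(7)[OF P t ij]]
  show "(P' t)\<^sup>T $$ (i, j) = P' t $$ (i, j)" using ij d[OF t] by simp
qed (use has_mat_derivD[OF P t] in auto)

text \<open>Uniqueness of the one-sided derivative is what evaluates the \<open>THE\<close> in
  \<open>mat_deriv\<close>.\<close>

lemma mat_deriv_eqI:
  assumes ab: "a < b" and F: "has_mat_deriv {a..b} nr nc F F'" and t: "t \<in> {a..b}"
  shows "mat_deriv {a..b} F t = F' t"
proof (rule eq_matI)
  note d = has_mat_derivD(3-6)[OF F t]
  fix i j assume "i < dim_row (F' t)" "j < dim_col (F' t)"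
  then have ij: "i < nr" "j < nc" using d by auto
  have "(THE D. ((\<lambda>s. F s $$ (i, j)) has_real_derivative D) (at t within {a..b})) = F' t $$ (i, j)"
    using has_mat_derivD(7)[OF F t ij] has_real_derivative_unique_Icc[OF ab t] by blast
  then show "mat_deriv {a..b} F t $$ (i, j) = F' t $$ (i, j)"
    using ij d by (simp add: mat_deriv_def)
qed (use has_mat_derivD[OF F t] in \<open>auto simp: mat_deriv_def\<close>)

lemma C1_mat_onI:
  assumes ab: "a < b" and F: "has_mat_deriv {a..b} nr nc F F'" and F': "continuous_mat_on {a..b} nr nc F'"
  shows "C1_mat_on {a..b} nr nc F"
  unfolding C1_mat_on_def
proof (intro conjI ballI allI impI)
  fix t assume t: "t \<in> {a..b}"
  show "F t \<in> carrier_mat nr nc" by (rule has_mat_derivD(1)[OF F t])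
  show "(\<lambda>s. F s $$ (i, j)) differentiable at t within {a..b}" if "i < nr" "j < nc" for i j
    using has_mat_derivD(7)[OF F t that] by (auto simp: real_differentiable_def)
next
  show "continuous_mat_on {a..b} nr nc (mat_deriv {a..b} F)"
    by (rule continuous_mat_onI[where f = "\<lambda>t i j. F' t $$ (i, j)"])
      (auto simp: mat_deriv_eqI[OF ab F] intro!: continuous_mat_onD[OF F'])
qed

lemma C1_mat_onD:
  assumes ab: "a < b" and F: "C1_mat_on {a..b} nr nc F"
  shows "has_mat_deriv {a..b} nr nc F (mat_deriv {a..b} F)"
    "continuous_mat_on {a..b} nr nc (mat_deriv {a..b} F)"
proof -
  show cont: "continuous_mat_on {a..b} nr nc (mat_deriv {a..b} F)"
    using F by (simp add: C1_mat_on_def)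
  show "has_mat_deriv {a..b} nr nc F (mat_deriv {a..b} F)"
    unfolding has_mat_deriv_def
  proof (intro ballI conjI allI impI)
    fix t assume t: "t \<in> {a..b}"
    show car: "F t \<in> carrier_mat nr nc" using F t by (simp add: C1_mat_on_def)
    show "mat_deriv {a..b} F t \<in> carrier_mat nr nc" by (rule continuous_mat_onD(1)[OF cont t])
    fix i j assume ij: "i < nr" "j < nc"
    obtain D where D: "((\<lambda>s. F s $$ (i, j)) has_real_derivative D) (at t within {a..b})"
      using F t ij unfolding C1_mat_on_def real_differentiable_def by blast
    then have "(THE D. ((\<lambda>s. F s $$ (i, j)) has_real_derivative D) (at t within {a..b})) = D"
      using has_real_derivative_unique_Icc[OF ab t] by blast
    then have "mat_deriv {a..b} F t $$ (i, j) = D"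
      using ij carrier_matD[OF car] by (simp add: mat_deriv_def)
    with D show "((\<lambda>s. F s $$ (i, j)) has_real_derivative mat_deriv {a..b} F t $$ (i, j)) (at t within {a..b})"
      by simp
  qed
qed

subsection \<open>The synthesis theorem\<close>

lemmas continuous_mat_on_intros = continuous_mat_on_add continuous_mat_on_minus
  continuous_mat_on_uminus continuous_mat_on_mult continuous_mat_on_four_block

theorem theorem3:
  fixes Tmin Tmax :: real and n m q mJ qJ :: nat
    and A B C AJ BJ CJ :: "real mat"
  assumes "0 < Tmin" and "Tmin < Tmax"
    and "A \<in> carrier_mat n n" and "B \<in> carrier_mat n m" and "C \<in> carrier_mat q n"
    and "AJ \<in> carrier_mat n n" and "BJ \<in> carrier_mat n mJ" and "CJ \<in> carrier_mat qJ n"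
  shows
    "(\<exists>nc Ac Bc Cc Dc AJc BJc CJc DJc.
        clock_controller Tmin Tmax m q mJ qJ nc Ac Bc Cc Dc AJc BJc CJc DJc \<and>
        clock_LMIs_feasible Tmin Tmax (n + nc)
          (\<lambda>\<tau>. closed_loop A B C (Ac \<tau>) (Bc \<tau>) (Cc \<tau>) (Dc \<tau>))
          (\<lambda>\<tau>. closed_loop AJ BJ CJ (AJc \<tau>) (BJc \<tau>) (CJc \<tau>) (DJc \<tau>)))
     \<longleftrightarrow>
     (\<exists>X Y K L M N KJ LJ MJ NJ.
        C1_mat_on {0..Tmax} n n X \<and> (\<forall>\<tau>\<in>{0..Tmax}. X \<tau> \<in> sym_mats n) \<and>
        C1_mat_on {0..Tmax} n n Y \<and> (\<forall>\<tau>\<in>{0..Tmax}. Y \<tau> \<in> sym_mats n) \<and>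
        continuous_mat_on {0..Tmax} n n K \<and>
        continuous_mat_on {0..Tmax} n q L \<and>
        continuous_mat_on {0..Tmax} m n M \<and>
        continuous_mat_on {0..Tmax} m q N \<and>
        continuous_mat_on {Tmin..Tmax} n n KJ \<and>
        continuous_mat_on {Tmin..Tmax} n qJ LJ \<and>
        continuous_mat_on {Tmin..Tmax} mJ n MJ \<and>
        continuous_mat_on {Tmin..Tmax} mJ qJ NJ \<and>
        (\<forall>\<tau>\<in>{0..Tmax}.
           pos_def (bold_X n (X \<tau>) (Y \<tau>)) \<and>
           (let bA = bold_A n m q A B C (X \<tau>) (Y \<tau>) (K \<tau>) (L \<tau>) (M \<tau>) (N \<tau>)
            in neg_def (bold_Z n (mat_deriv {0..Tmax} X \<tau>) (mat_deriv {0..Tmax} Y \<tau>)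
                        + bA\<^sup>T + bA))) \<and>
        (\<forall>\<tau>\<in>{Tmin..Tmax}.
           let bAJ = bold_A n mJ qJ AJ BJ CJ (X 0) (Y \<tau>) (KJ \<tau>) (LJ \<tau>) (MJ \<tau>) (NJ \<tau>)
           in pos_def (four_block_mat (bold_X n (X \<tau>) (Y \<tau>)) (bAJ\<^sup>T)
                                      bAJ (bold_X n (X 0) (Y 0)))))"
  (is "?controller \<longleftrightarrow> ?synthesis")
proof
  let ?I = "{0..Tmax}" and ?J = "{Tmin..Tmax}"
  note plant = assms(3-5) and plantJ = assms(6-8)
  note const = plant[THEN continuous_mat_on_const] plantJ[THEN continuous_mat_on_const]
  have T: "0 < Tmax" using assms(1,2) by simp
  have JI: "?J \<subseteq> ?I" using assms(1) by auto
  have I0: "0 \<in> ?I" using T by simp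
  {
    assume ?controller
    then obtain k Ac Bc Cc Dc AJc BJc CJc DJc where
      ctrl: "clock_controller Tmin Tmax m q mJ qJ k Ac Bc Cc Dc AJc BJc CJc DJc" and
      feas: "clock_LMIs_feasible Tmin Tmax (n + k)
          (\<lambda>\<tau>. closed_loop A B C (Ac \<tau>) (Bc \<tau>) (Cc \<tau>) (Dc \<tau>))
          (\<lambda>\<tau>. closed_loop AJ BJ CJ (AJc \<tau>) (BJc \<tau>) (CJc \<tau>) (DJc \<tau>))"
      by blast
    have c: "continuous_mat_on ?I k k Ac" "continuous_mat_on ?I k q Bc"
      "continuous_mat_on ?I m k Cc" "continuous_mat_on ?I m q Dc"
      and cJ: "continuous_mat_on ?J k k AJc" "continuous_mat_on ?J k qJ BJc"
      "continuous_mat_on ?J mJ k CJc" "continuous_mat_on ?J mJ qJ DJc"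
      using ctrl by (simp_all only: clock_controller_def)
    note ccar = c[THEN continuous_mat_onD(1)] and cJcar = cJ[THEN continuous_mat_onD(1)]
    from feas obtain P where C1P: "C1_mat_on ?I (n + k) (n + k) P"
      and pd: "\<And>t. t \<in> ?I \<Longrightarrow> pos_def (P t)"
      and flow: "\<And>t. t \<in> ?I \<Longrightarrow> neg_def (mat_deriv ?I P t +
        (closed_loop A B C (Ac t) (Bc t) (Cc t) (Dc t))\<^sup>T * P t +
        P t * closed_loop A B C (Ac t) (Bc t) (Cc t) (Dc t))"
      and jump: "\<And>t. t \<in> ?J \<Longrightarrow> neg_def ((closed_loop AJ BJ CJ (AJc t) (BJc t) (CJc t) (DJc t))\<^sup>T * P 0 *
        closed_loop AJ BJ CJ (AJc t) (BJc t) (CJc t) (DJc t) - P t)"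
      unfolding clock_LMIs_feasible_def by blast
    define P' where "P' = mat_deriv ?I P"
    have P: "has_mat_deriv ?I (n + k) (n + k) P P'" and P'c: "continuous_mat_on ?I (n + k) (n + k) P'"
      using C1_mat_onD[OF T C1P] by (simp_all only: P'_def)
    note Pc = has_mat_deriv_continuous[OF P]
    note Pcar = has_mat_derivD(1)[OF P] and P'car = has_mat_derivD(2)[OF P]
    have Psym: "(P t)\<^sup>T = P t" if "t \<in> ?I" for t
      by (rule pos_defD(1)[OF pd[OF that] Pcar[OF that]])
    have P'sym: "(P' t)\<^sup>T = P' t" if "t \<in> ?I" for t
      by (rule has_mat_deriv_transpose[OF T P Psym that])
    have det: "det (P t) \<noteq> 0" if "t \<in> ?I" for t
      by (rule pos_def_det_nonzero[OF pd[OF that] Pcar[OF that]])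
    define R where "R = (\<lambda>t. mat_inv (P t))"
    have R: "R t \<in> carrier_mat (n + k) (n + k)" "P t * R t = 1\<^sub>m (n + k)" "R t * P t = 1\<^sub>m (n + k)"
      if "t \<in> ?I" for t
      unfolding R_def by (rule mat_inv[OF Pcar[OF that] det[OF that]])+
    have Rc: "continuous_mat_on ?I (n + k) (n + k) R"
      unfolding R_def by (rule continuous_mat_on_mat_inv[OF Pc det])
    note R' = has_mat_deriv_inverse[OF P Rc R(2,3)]
    have R'c: "continuous_mat_on ?I (n + k) (n + k) (\<lambda>t. - (R t * P' t * R t))"
      by (rule continuous_mat_on_intros Rc P'c)+
    have Rsym: "(R t)\<^sup>T = R t" if "t \<in> ?I" for t
      by (rule inverse_transpose_sym(1)[OF Pcar[OF that] Psym[OF that] R(1,2)[OF that]])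
    \<comment> \<open>The factor 2 in \<open>Y\<close> and \<open>V\<close> is the doubling that the
      additional \<open>S\<close> congruence requires.\<close>
    define X Y U V where "X = (\<lambda>t. sub_block 0 0 n n (P t))"
      and "Y = (\<lambda>t. 2 \<cdot>\<^sub>m sub_block 0 0 n n (R t))"
      and "U = (\<lambda>t. sub_block 0 n n k (P t))"
      and "V = (\<lambda>t. 2 \<cdot>\<^sub>m sub_block n 0 k n (R t))"
    define X' Y' where "X' = (\<lambda>t. sub_block 0 0 n n (P' t))"
      and "Y' = (\<lambda>t. 2 \<cdot>\<^sub>m sub_block 0 0 n n (- (R t * P' t * R t)))"
    have X: "has_mat_deriv ?I n n X X'" and Y: "has_mat_deriv ?I n n Y Y'"
      unfolding X_def X'_def Y_def Y'_def
      by (intro has_mat_deriv_smult has_mat_deriv_sub_block[OF P] has_mat_deriv_sub_block[OF R']; simp)+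
    have X'c: "continuous_mat_on ?I n n X'" and Y'c: "continuous_mat_on ?I n n Y'"
      unfolding X'_def Y'_def
      by ((rule continuous_mat_on_smult continuous_on_const continuous_mat_on_sub_block[OF P'c]
          continuous_mat_on_sub_block[OF R'c])+; simp)+
    have Xc: "continuous_mat_on ?I n n X" and Yc: "continuous_mat_on ?I n n Y"
      and Uc: "continuous_mat_on ?I n k U" and Vc: "continuous_mat_on ?I k n V"
      unfolding X_def Y_def U_def V_def
      by ((rule continuous_mat_on_smult continuous_on_const continuous_mat_on_sub_block[OF Pc]
          continuous_mat_on_sub_block[OF Rc])+; simp)+
    have X0c: "continuous_mat_on S n n (\<lambda>_. X 0)" and U0c: "continuous_mat_on S n k (\<lambda>_. U 0)" for S
      by (intro continuous_mat_on_const continuous_mat_onD(1)[OF Xc I0] continuous_mat_onD(1)[OF Uc I0])+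
    note YJ = continuous_mat_on_subset[OF Yc JI] and VJ = continuous_mat_on_subset[OF Vc JI]
    \<comment> \<open>The last summand of \<open>K\<close> absorbs the off-diagonal blocks created
      by the derivative of \<open>P\<close>.\<close>
    define K L M where "K = (\<lambda>t. synthesis_K A B C (X t) (U t) (Y t) (V t) (Ac t) (Bc t) (Cc t) (Dc t) +
        sub_block 0 0 n n (P' t * R t))"
      and "L = (\<lambda>t. X t * (B * Dc t) + U t * Bc t)"
      and "M = (\<lambda>t. Dc t * C * Y t + Cc t * V t)"
    \<comment> \<open>The blocks \<open>X 0\<close> and \<open>U 0\<close> come from the certificate
      after the impulse, \<open>Y t\<close> and \<open>V t\<close> from the one before it.\<close>
    define KJ LJ MJ where
      "KJ = (\<lambda>t. synthesis_K AJ BJ CJ (X 0) (U 0) (Y t) (V t) (AJc t) (BJc t) (CJc t) (DJc t))"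
      and "LJ = (\<lambda>t. X 0 * (BJ * DJc t) + U 0 * BJc t)"
      and "MJ = (\<lambda>t. DJc t * CJ * Y t + CJc t * V t)"
    have P'R: "continuous_mat_on ?I n n (\<lambda>t. sub_block 0 0 n n (P' t * R t))"
      by (rule continuous_mat_on_sub_block[OF continuous_mat_on_mult[OF P'c Rc]]) simp_all
    have Kc: "continuous_mat_on ?I n n K" and Lc: "continuous_mat_on ?I n q L"
      and Mc: "continuous_mat_on ?I m n M"
      unfolding K_def L_def M_def synthesis_K_def
      by (rule continuous_mat_on_intros continuous_mat_on_smult continuous_on_const const c Xc Yc Uc Vc P'R)+
    have KJc: "continuous_mat_on ?J n n KJ" and LJc: "continuous_mat_on ?J n qJ LJ"
      and MJc: "continuous_mat_on ?J mJ n MJ"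
      unfolding KJ_def LJ_def MJ_def synthesis_K_def
      by (rule continuous_mat_on_intros continuous_mat_on_smult continuous_on_const const cJ X0c U0c YJ VJ)+
    have C1: "C1_mat_on ?I n n X" "C1_mat_on ?I n n Y"
      by (rule C1_mat_onI[OF T X X'c] C1_mat_onI[OF T Y Y'c])+
    have sym: "(X t)\<^sup>T = X t" "(Y t)\<^sup>T = Y t" if t: "t \<in> ?I" for t
      by (simp_all add: X_def Y_def dim_transpose_smult sub_block_transpose[OF Pcar[OF t]]
          sub_block_transpose[OF R(1)[OF t]] Psym[OF t] Rsym[OF t])
    have Xsym: "\<forall>\<tau>\<in>?I. X \<tau> \<in> sym_mats n" and Ysym: "\<forall>\<tau>\<in>?I. Y \<tau> \<in> sym_mats n"
      using sym continuous_mat_onD(1)[OF Xc] continuous_mat_onD(1)[OF Yc]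
      unfolding sym_mats_def by blast+
    have flow': "\<forall>\<tau>\<in>?I. pos_def (bold_X n (X \<tau>) (Y \<tau>)) \<and>
       (let bA = bold_A n m q A B C (X \<tau>) (Y \<tau>) (K \<tau>) (L \<tau>) (M \<tau>) (Dc \<tau>)
        in neg_def (bold_Z n (mat_deriv {0..Tmax} X \<tau>) (mat_deriv {0..Tmax} Y \<tau>) + bA\<^sup>T + bA))"
    proof (intro ballI conjI)
      fix t assume t: "t \<in> ?I"
      show "pos_def (bold_X n (X t) (Y t))"
        unfolding X_def Y_def by (rule pos_def_bold_X_necessity[OF Pcar[OF t] R(1)[OF t] pd[OF t] R(2)[OF t]])
      show "let bA = bold_A n m q A B C (X t) (Y t) (K t) (L t) (M t) (Dc t)
        in neg_def (bold_Z n (mat_deriv {0..Tmax} X t) (mat_deriv {0..Tmax} Y t) + bA\<^sup>T + bA)"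
        unfolding Let_def mat_deriv_eqI[OF T X t] mat_deriv_eqI[OF T Y t]
        unfolding X_def Y_def U_def V_def X'_def Y'_def K_def L_def M_def
        by (rule neg_def_flow_necessity[OF plant ccar[OF t] Pcar[OF t] R(1)[OF t] P'car[OF t]
              Psym[OF t] P'sym[OF t] R(2)[OF t] flow[OF t, folded P'_def]])
    qed
    have jump': "\<forall>\<tau>\<in>?J. let bAJ = bold_A n mJ qJ AJ BJ CJ (X 0) (Y \<tau>) (KJ \<tau>) (LJ \<tau>) (MJ \<tau>) (DJc \<tau>)
       in pos_def (four_block_mat (bold_X n (X \<tau>) (Y \<tau>)) (bAJ\<^sup>T) bAJ (bold_X n (X 0) (Y 0)))"
    proof
      fix t assume tJ: "t \<in> ?J"
      then have t: "t \<in> ?I" using JI by blast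
      show "let bAJ = bold_A n mJ qJ AJ BJ CJ (X 0) (Y t) (KJ t) (LJ t) (MJ t) (DJc t)
       in pos_def (four_block_mat (bold_X n (X t) (Y t)) (bAJ\<^sup>T) bAJ (bold_X n (X 0) (Y 0)))"
        unfolding Let_def X_def Y_def U_def V_def KJ_def LJ_def MJ_def
        by (rule pos_def_jump_necessity[OF plantJ cJcar[OF tJ] Pcar[OF t] R(1)[OF t] Pcar[OF I0]
              R(1)[OF I0] pd[OF t] pd[OF I0] R(2)[OF t] R(2)[OF I0] jump[OF tJ]])
    qed
    \<comment> \<open>The feedthrough maps \<open>Dc\<close> and \<open>DJc\<close> themselves serve
      as \<open>N\<close> and \<open>NJ\<close>.\<close>
    show ?synthesis
      by (intro exI conjI; fact C1(1) C1(2) Xsym Ysym Kc Lc Mc c(4) KJc LJc MJc cJ(4) flow' jump')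
  next
    assume ?synthesis
    then obtain X Y K L M N KJ LJ MJ NJ where
      C1: "C1_mat_on ?I n n X" "C1_mat_on ?I n n Y"
      and Xsym: "\<forall>\<tau>\<in>?I. X \<tau> \<in> sym_mats n" and Ysym: "\<forall>\<tau>\<in>?I. Y \<tau> \<in> sym_mats n"
      and KLMN: "continuous_mat_on ?I n n K" "continuous_mat_on ?I n q L"
        "continuous_mat_on ?I m n M" "continuous_mat_on ?I m q N"
      and KLMNJ: "continuous_mat_on ?J n n KJ" "continuous_mat_on ?J n qJ LJ"
        "continuous_mat_on ?J mJ n MJ" "continuous_mat_on ?J mJ qJ NJ"
      and flow: "\<forall>\<tau>\<in>?I. pos_def (bold_X n (X \<tau>) (Y \<tau>)) \<and>
       (let bA = bold_A n m q A B C (X \<tau>) (Y \<tau>) (K \<tau>) (L \<tau>) (M \<tau>) (N \<tau>)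
        in neg_def (bold_Z n (mat_deriv {0..Tmax} X \<tau>) (mat_deriv {0..Tmax} Y \<tau>) + bA\<^sup>T + bA))"
      and jump: "\<forall>\<tau>\<in>?J. let bAJ = bold_A n mJ qJ AJ BJ CJ (X 0) (Y \<tau>) (KJ \<tau>) (LJ \<tau>) (MJ \<tau>) (NJ \<tau>)
       in pos_def (four_block_mat (bold_X n (X \<tau>) (Y \<tau>)) (bAJ\<^sup>T) bAJ (bold_X n (X 0) (Y 0)))"
      by (elim exE conjE) blast
    define X' Y' where "X' = mat_deriv ?I X" and "Y' = mat_deriv ?I Y"
    have X: "has_mat_deriv ?I n n X X'" and X'c: "continuous_mat_on ?I n n X'"
      and Y: "has_mat_deriv ?I n n Y Y'" and Y'c: "continuous_mat_on ?I n n Y'"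
      using C1_mat_onD[OF T C1(1)] C1_mat_onD[OF T C1(2)] by (simp_all only: X'_def Y'_def)
    note Xc = has_mat_deriv_continuous[OF X] and Yc = has_mat_deriv_continuous[OF Y]
    note Xcar = has_mat_derivD(1)[OF X] and X'car = has_mat_derivD(2)[OF X]
      and Ycar = has_mat_derivD(1)[OF Y] and Y'car = has_mat_derivD(2)[OF Y]
    have sym: "(X t)\<^sup>T = X t" "(Y t)\<^sup>T = Y t" if "t \<in> ?I" for t
      using Xsym Ysym that by (simp_all only: sym_mats_def mem_Collect_eq)
    have Y'sym: "(Y' t)\<^sup>T = Y' t" if "t \<in> ?I" for t
      by (rule has_mat_deriv_transpose[OF T Y sym(2) that])
    have pdX: "pos_def (bold_X n (X t) (Y t))" if "t \<in> ?I" for t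
      using flow that by blast
    have det: "det (Y t) \<noteq> 0" if "t \<in> ?I" for t
      by (rule pos_def_det_nonzero[OF pos_def_leading_block[OF Ycar[OF that] one_carrier_mat
              one_carrier_mat Xcar[OF that] pdX[OF that, unfolded bold_X_def]] Ycar[OF that]])
    define W where "W = (\<lambda>t. mat_inv (Y t))"
    have W: "W t \<in> carrier_mat n n" "Y t * W t = 1\<^sub>m n" "W t * Y t = 1\<^sub>m n" if "t \<in> ?I" for t
      unfolding W_def by (rule mat_inv[OF Ycar[OF that] det[OF that]])+
    have Wc: "continuous_mat_on ?I n n W"
      unfolding W_def by (rule continuous_mat_on_mat_inv[OF Yc det])
    define W' where "W' = (\<lambda>t. - (W t * Y' t * W t))"
    have W': "has_mat_deriv ?I n n W W'"
      unfolding W'_def by (rule has_mat_deriv_inverse[OF Y Wc W(2,3)])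
    have W'c: "continuous_mat_on ?I n n W'"
      unfolding W'_def by (rule continuous_mat_on_intros Wc Y'c)+
    \<comment> \<open>The sign arises because \<open>X - W\<close> is the definite matrix, while the
      coupling block to be inverted is \<open>W - X\<close>.\<close>
    define Ui where "Ui = (\<lambda>t. - mat_inv (X t - W t))"
    have XWc: "continuous_mat_on ?I n n (\<lambda>t. X t - W t)"
      by (rule continuous_mat_on_intros Xc Wc)+
    note XWcar = continuous_mat_onD(1)[OF XWc]
    have detXW: "det (X t - W t) \<noteq> 0" if "t \<in> ?I" for t
      by (rule pos_def_det_nonzero[OF pos_def_bold_XD[OF Xcar[OF that] Ycar[OF that] W(1,2)[OF that]
              pdX[OF that]] XWcar[OF that]])
    have Uic: "continuous_mat_on ?I n n Ui"
      unfolding Ui_def by (rule continuous_mat_on_intros continuous_mat_on_mat_inv XWc detXW)+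
    note Uicar = continuous_mat_onD(1)[OF Uic]
    have Ui: "(W t - X t) * Ui t = 1\<^sub>m n" if t: "t \<in> ?I" for t
    proof -
      note inv = mat_inv[OF XWcar[OF t] detXW[OF t]]
      note d = carrier_matD[OF Xcar[OF t]] carrier_matD[OF W(1)[OF t]] carrier_matD[OF inv(1)]
      have "W t - X t = - (X t - W t)" by (rule eq_matI) (auto simp: d)
      then have "(W t - X t) * Ui t = - (- ((X t - W t) * mat_inv (X t - W t)))"
        by (simp only: Ui_def dim_mult_uminus dim_uminus_mult mat_dim_simps d)
      then show ?thesis by (simp only: inv(2) uminus_uminus_mat)
    qed
    define P where "P = (\<lambda>t. four_block_mat (X t) (W t - X t) (W t - X t) (X t - W t))"
    define P' where "P' = (\<lambda>t. four_block_mat (X' t) (W' t - X' t) (W' t - X' t) (X' t - W' t))"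
    have P: "has_mat_deriv ?I (n + n) (n + n) P P'"
      unfolding P_def P'_def by (intro has_mat_deriv_four_block has_mat_deriv_minus X W')
    have P'c: "continuous_mat_on ?I (n + n) (n + n) P'"
      unfolding P'_def by (rule continuous_mat_on_intros X'c W'c)+
    note Pcar = has_mat_derivD(1)[OF P]
    have pdP: "pos_def (P t)" if t: "t \<in> ?I" for t
      unfolding P_def
      by (rule sufficiency_pos_def[OF Xcar[OF t] Ycar[OF t] W(1)[OF t] sym(2)[OF t] W(2,3)[OF t] pdX[OF t]])
    \<comment> \<open>The controller has \<open>n\<close> states. Its state matrix is built from
      \<open>K\<close> shifted by \<open>W\<close> times the derivative of \<open>Y\<close>.\<close>
    define Ac Bc Cc where
      "Ac = (\<lambda>t. controller_A A B C (X t) (Y t) (Ui t) (W t) (K t + W t * Y' t) (L t) (M t) (N t))"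
      and "Bc = (\<lambda>t. controller_B B (X t) (Ui t) (L t) (N t))"
      and "Cc = (\<lambda>t. controller_C C (Y t) (W t) (M t) (N t))"
    \<comment> \<open>No shift of \<open>KJ\<close> here; \<open>X\<close> and \<open>Ui\<close> are
      frozen at clock value 0, the value reached by the impulse.\<close>
    define AJc BJc CJc where
      "AJc = (\<lambda>t. controller_A AJ BJ CJ (X 0) (Y t) (Ui 0) (W t) (KJ t) (LJ t) (MJ t) (NJ t))"
      and "BJc = (\<lambda>t. controller_B BJ (X 0) (Ui 0) (LJ t) (NJ t))"
      and "CJc = (\<lambda>t. controller_C CJ (Y t) (W t) (MJ t) (NJ t))"
    have X0c: "continuous_mat_on S n n (\<lambda>_. X 0)" and Ui0c: "continuous_mat_on S n n (\<lambda>_. Ui 0)" for S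
      by (intro continuous_mat_on_const Xcar[OF I0] Uicar[OF I0])+
    note YJ = continuous_mat_on_subset[OF Yc JI] and WJ = continuous_mat_on_subset[OF Wc JI]
    have "continuous_mat_on ?I n n Ac" "continuous_mat_on ?I n q Bc" "continuous_mat_on ?I m n Cc"
      unfolding Ac_def Bc_def Cc_def controller_A_def controller_B_def controller_C_def
      by (rule continuous_mat_on_intros const KLMN Xc Yc Y'c Uic Wc)+
    moreover have "continuous_mat_on ?J n n AJc" "continuous_mat_on ?J n qJ BJc" "continuous_mat_on ?J mJ n CJc"
      unfolding AJc_def BJc_def CJc_def controller_A_def controller_B_def controller_C_def
      by (rule continuous_mat_on_intros const KLMNJ X0c YJ Ui0c WJ)+
    ultimately have ctrl: "clock_controller Tmin Tmax m q mJ qJ n Ac Bc Cc N AJc BJc CJc NJ"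
      using KLMN KLMNJ by (simp only: clock_controller_def simp_thms)
    have flow': "neg_def (mat_deriv ?I P t + (closed_loop A B C (Ac t) (Bc t) (Cc t) (N t))\<^sup>T * P t +
        P t * closed_loop A B C (Ac t) (Bc t) (Cc t) (N t))" if t: "t \<in> ?I" for t
      unfolding mat_deriv_eqI[OF T P t] Ac_def Bc_def Cc_def
    proof (rule neg_def_flow_sufficiency[OF plant KLMN[THEN continuous_mat_onD(1), OF t]
          Xcar[OF t] X'car[OF t] Ycar[OF t] Y'car[OF t] W(1)[OF t] Uicar[OF t] sym[OF t] Y'sym[OF t]
          W(2,3)[OF t] Ui[OF t]])
      show "P t = four_block_mat (X t) (W t - X t) (W t - X t) (X t - W t)" by (simp only: P_def)
      show "P' t = four_block_mat (X' t) (- (W t * Y' t * W t) - X' t) (- (W t * Y' t * W t) - X' t)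
          (X' t - - (W t * Y' t * W t))" by (simp only: P'_def W'_def)
      show "neg_def (bold_Z n (X' t) (Y' t) + (bold_A n m q A B C (X t) (Y t) (K t) (L t) (M t) (N t))\<^sup>T +
          bold_A n m q A B C (X t) (Y t) (K t) (L t) (M t) (N t))"
        using flow t unfolding Let_def X'_def Y'_def by blast
    qed
    have jump': "neg_def ((closed_loop AJ BJ CJ (AJc t) (BJc t) (CJc t) (NJ t))\<^sup>T * P 0 *
        closed_loop AJ BJ CJ (AJc t) (BJc t) (CJc t) (NJ t) - P t)" if tJ: "t \<in> ?J" for t
    proof -
      have t: "t \<in> ?I" using tJ JI by blast
      show ?thesis
        unfolding AJc_def BJc_def CJc_def
      proof (rule neg_def_jump_sufficiency[OF plantJ KLMNJ[THEN continuous_mat_onD(1), OF tJ]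
          Xcar[OF t] Xcar[OF I0] Ycar[OF t] Ycar[OF I0] W(1)[OF t] W(1)[OF I0] Uicar[OF I0]
          sym(1)[OF I0] sym(2)[OF t] sym(2)[OF I0] W(2,3)[OF t] W(2,3)[OF I0] Ui[OF I0]])
        show "P t = four_block_mat (X t) (W t - X t) (W t - X t) (X t - W t)"
          "P 0 = four_block_mat (X 0) (W 0 - X 0) (W 0 - X 0) (X 0 - W 0)" by (simp_all only: P_def)
        show "pos_def (four_block_mat (bold_X n (X t) (Y t))
            ((bold_A n mJ qJ AJ BJ CJ (X 0) (Y t) (KJ t) (LJ t) (MJ t) (NJ t))\<^sup>T)
            (bold_A n mJ qJ AJ BJ CJ (X 0) (Y t) (KJ t) (LJ t) (MJ t) (NJ t)) (bold_X n (X 0) (Y 0)))"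
          using jump tJ unfolding Let_def by blast
      qed
    qed
    have "\<forall>\<tau>\<in>?I. P \<tau> \<in> sym_mats (n + n)"
      using pos_defD(1)[OF pdP Pcar] Pcar by (simp only: sym_mats_def mem_Collect_eq) blast
    then have feas: "clock_LMIs_feasible Tmin Tmax (n + n)
        (\<lambda>\<tau>. closed_loop A B C (Ac \<tau>) (Bc \<tau>) (Cc \<tau>) (N \<tau>))
        (\<lambda>\<tau>. closed_loop AJ BJ CJ (AJc \<tau>) (BJc \<tau>) (CJc \<tau>) (NJ \<tau>))"
      unfolding clock_LMIs_feasible_def
      using C1_mat_onI[OF T P P'c] pdP flow' jump' by blast
    show ?controller
      by (intro exI, rule conjI, rule ctrl, rule feas)
  }
qed

end
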